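(* Let $M^n$ be a connected, simply connected $n$-dimensional Riemannian manifold and let $N^n$ be a connected compact $n$-dimensional submanifold of the tangent bundle $TM^n$ which is everywhere transverse to the fibers of $TM^n$. Then $M^n$ is compact, and there is a vector field $\xi$ on $M^n$ such that $\xi(M^n)=N^n$.
   Context: All manifolds, maps and vector fields are smooth ($C^\infty$). Let $\pi:TM^n\to M^n$ be the projection. $N\subset TM^n$ is transverse to the fiber at $z\in N$ if $T_zN\cap\ker(d\pi_z)=\{0\}$; it is everywhere transverse to the fibers if this holds at all $z\in N$. A vector field $\xi$ is regarded as a map $\xi:M^n\to TM^n$ and $\xi(M^n)$ is its image. *)

theory Defs
  imports "HOL-Analysis.Analysis"
begin

section \<open>Smooth maps between open subsets of normed spaces\<close>

primrec Ck_on :: "nat \<Rightarrow> ('e::real_normed_vector \<Rightarrow> 'f::real_normed_vector) \<Rightarrow> 'e set \<Rightarrow> bool" where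
  "Ck_on 0 f S \<longleftrightarrow> continuous_on S f"
| "Ck_on (Suc k) f S \<longleftrightarrow>
     (\<forall>x\<in>S. f differentiable (at x)) \<and> (\<forall>v. Ck_on k (\<lambda>x. frechet_derivative f (at x) v) S)"

text \<open>Meant for open \<open>S\<close> only: derivatives are taken in the full neighbourhood filter.\<close>

definition smooth_on :: "('e::real_normed_vector \<Rightarrow> 'f::real_normed_vector) \<Rightarrow> 'e set \<Rightarrow> bool" where
  "smooth_on f S \<longleftrightarrow> (\<forall>k. Ck_on k f S)"


section \<open>Smooth manifolds and smooth maps\<close>

text \<open>
  A chart is a pair \<open>(U, \<phi>)\<close> of a domain and a coordinate map; the values of \<open>\<phi>\<close> outside
  \<open>U\<close> are never used. A manifold without boundary is given by a topology and a smooth atlas,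
  which need not be maximal; its points are \<open>topspace X\<close>, its dimension is the dimension of
  the Euclidean space in which the charts take their values.
\<close>

type_synonym ('a, 'e) chart = "'a set \<times> ('a \<Rightarrow> 'e)"

definition is_chart :: "'a topology \<Rightarrow> ('a, 'e::euclidean_space) chart \<Rightarrow> bool" where
  "is_chart X c \<longleftrightarrow> openin X (fst c) \<and> open (snd c ` fst c) \<and>
     homeomorphic_map (subtopology X (fst c)) (top_of_set (snd c ` fst c)) (snd c)"

text \<open>The expression of a map \<open>f\<close> in charts \<open>c\<close> and \<open>d\<close>.\<close>

definition local_rep ::
    "('a, 'e) chart \<Rightarrow> ('b, 'f) chart \<Rightarrow> ('a \<Rightarrow> 'b) \<Rightarrow> 'e \<Rightarrow> 'f" where
  "local_rep c d f = snd d \<circ> f \<circ> inv_into (fst c) (snd c)"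

abbreviation transition :: "('a, 'e) chart \<Rightarrow> ('a, 'f) chart \<Rightarrow> 'e \<Rightarrow> 'f" where
  "transition c d \<equiv> local_rep c d id"

definition compatible ::
    "('a, 'e::euclidean_space) chart \<Rightarrow> ('a, 'e) chart \<Rightarrow> bool" where
  "compatible c d \<longleftrightarrow>
     smooth_on (transition c d) (snd c ` (fst c \<inter> fst d)) \<and>
     smooth_on (transition d c) (snd d ` (fst c \<inter> fst d))"

definition smooth_atlas :: "'a topology \<Rightarrow> ('a, 'e::euclidean_space) chart set \<Rightarrow> bool" where
  "smooth_atlas X A \<longleftrightarrow>
     (\<forall>c\<in>A. is_chart X c) \<and> (\<Union>c\<in>A. fst c) = topspace X \<and> (\<forall>c\<in>A. \<forall>d\<in>A. compatible c d)"

definition smooth_manifold :: "'a topology \<Rightarrow> ('a, 'e::euclidean_space) chart set \<Rightarrow> bool" where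
  "smooth_manifold X A \<longleftrightarrow> Hausdorff_space X \<and> second_countable X \<and> smooth_atlas X A"

definition maximal_atlas ::
    "'a topology \<Rightarrow> ('a, 'e::euclidean_space) chart set \<Rightarrow> ('a, 'e) chart set" where
  "maximal_atlas X A = {c. is_chart X c \<and> (\<forall>d\<in>A. compatible c d)}"

definition smooth_map ::
    "'a topology \<Rightarrow> ('a, 'e::euclidean_space) chart set \<Rightarrow>
     'b topology \<Rightarrow> ('b, 'f::euclidean_space) chart set \<Rightarrow> ('a \<Rightarrow> 'b) \<Rightarrow> bool" where
  "smooth_map X A Y B f \<longleftrightarrow> continuous_map X Y f \<and>
     (\<forall>c\<in>A. \<forall>d\<in>B. smooth_on (local_rep c d f) (snd c ` {p \<in> fst c. f p \<in> fst d}))"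


section \<open>Tangent vectors and differentials\<close>

text \<open>
  A tangent vector at \<open>p\<close> is the family of its coordinate vectors in all charts of the atlas
  around \<open>p\<close>, related by the derivatives of the transition maps. The entries at all other
  indices are set to \<open>0\<close>, so that equality of functions is equality of tangent vectors;
  the vector space operations are pointwise.
\<close>

type_synonym ('a, 'e) tvec = "('a, 'e) chart \<Rightarrow> 'e"

definition tangent_space ::
    "('a, 'e::euclidean_space) chart set \<Rightarrow> 'a \<Rightarrow> ('a, 'e) tvec set" where
  "tangent_space A p = {v.
     (\<forall>c. \<not> (c \<in> A \<and> p \<in> fst c) \<longrightarrow> v c = 0) \<and>
     (\<forall>c\<in>A. \<forall>d\<in>A. p \<in> fst c \<and> p \<in> fst d \<longrightarrow>
        v d = frechet_derivative (transition c d) (at (snd c p)) (v c))}"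

text \<open>The tangent vector at \<open>p\<close> whose coordinate vector in the chart \<open>c\<close> is \<open>e\<close>.\<close>

definition coord_vec ::
    "('a, 'e::euclidean_space) chart set \<Rightarrow> ('a, 'e) chart \<Rightarrow> 'a \<Rightarrow> 'e \<Rightarrow> ('a, 'e) tvec" where
  "coord_vec A c p e = (\<lambda>d. if d \<in> A \<and> p \<in> fst d
     then frechet_derivative (transition c d) (at (snd c p)) e else 0)"

text \<open>
  The chart used on the source side is arbitrary: by the chain rule the result does not depend
  on it when \<open>f\<close> is smooth and \<open>v \<in> tangent_space A p\<close>.
\<close>

definition differential ::
    "('a, 'e::euclidean_space) chart set \<Rightarrow> ('b, 'f::euclidean_space) chart set \<Rightarrow>
     ('a \<Rightarrow> 'b) \<Rightarrow> 'a \<Rightarrow> ('a, 'e) tvec \<Rightarrow> ('b, 'f) tvec" where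
  "differential A B f p v = (let c = (SOME c. c \<in> A \<and> p \<in> fst c) in
     (\<lambda>d. if d \<in> B \<and> f p \<in> fst d
       then frechet_derivative (local_rep c d f) (at (snd c p)) (v c) else 0))"


section \<open>The tangent bundle\<close>

definition tangent_bundle ::
    "'a topology \<Rightarrow> ('a, 'e::euclidean_space) chart set \<Rightarrow> ('a \<times> ('a, 'e) tvec) set" where
  "tangent_bundle X A = Sigma (topspace X) (tangent_space A)"

definition tangent_chart ::
    "'a topology \<Rightarrow> ('a, 'e::euclidean_space) chart set \<Rightarrow> ('a, 'e) chart \<Rightarrow>
     ('a \<times> ('a, 'e) tvec, 'e \<times> 'e) chart" where
  "tangent_chart X A c =
     ({z \<in> tangent_bundle X A. fst z \<in> fst c}, \<lambda>z. (snd c (fst z), snd z c))"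

definition tangent_atlas ::
    "'a topology \<Rightarrow> ('a, 'e::euclidean_space) chart set \<Rightarrow>
     ('a \<times> ('a, 'e) tvec, 'e \<times> 'e) chart set" where
  "tangent_atlas X A = tangent_chart X A ` A"

text \<open>The topology for which all the tangent charts are homeomorphisms onto open sets.\<close>

definition tangent_topology ::
    "'a topology \<Rightarrow> ('a, 'e::euclidean_space) chart set \<Rightarrow> ('a \<times> ('a, 'e) tvec) topology" where
  "tangent_topology X A = topology_generated_by
     {{z \<in> fst C. snd C z \<in> W} | C W. C \<in> tangent_atlas X A \<and> open W}"

text \<open>The bundle projection is \<^const>\<open>fst\<close>.\<close>

definition vector_field ::
    "'a topology \<Rightarrow> ('a, 'e::euclidean_space) chart set \<Rightarrow> ('a \<Rightarrow> 'a \<times> ('a, 'e) tvec) \<Rightarrow> bool" where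
  "vector_field X A \<xi> \<longleftrightarrow>
     smooth_map X A (tangent_topology X A) (tangent_atlas X A) \<xi> \<and>
     (\<forall>p\<in>topspace X. fst (\<xi> p) = p)"

definition riemannian_metric ::
    "'a topology \<Rightarrow> ('a, 'e::euclidean_space) chart set \<Rightarrow>
     ('a \<Rightarrow> ('a, 'e) tvec \<Rightarrow> ('a, 'e) tvec \<Rightarrow> real) \<Rightarrow> bool" where
  "riemannian_metric X A g \<longleftrightarrow>
     (\<forall>p\<in>topspace X.
        (\<forall>u\<in>tangent_space A p. \<forall>v\<in>tangent_space A p. \<forall>w\<in>tangent_space A p. \<forall>a b.
           g p (\<lambda>c. a *\<^sub>R u c + b *\<^sub>R v c) w = a * g p u w + b * g p v w) \<and>
        (\<forall>u\<in>tangent_space A p. \<forall>v\<in>tangent_space A p. g p u v = g p v u) \<and>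
        (\<forall>v\<in>tangent_space A p. v \<noteq> (\<lambda>_. 0) \<longrightarrow> g p v v > 0)) \<and>
     (\<forall>c\<in>A. \<forall>e e'. smooth_on
        (\<lambda>x. let p = inv_into (fst c) (snd c) x in g p (coord_vec A c p e) (coord_vec A c p e'))
        (snd c ` fst c))"


section \<open>Submanifolds\<close>

text \<open>Embedded \<open>k\<close>-dimensional submanifolds without boundary, by slice charts.\<close>

definition submanifold ::
    "'a topology \<Rightarrow> ('a, 'e::euclidean_space) chart set \<Rightarrow> nat \<Rightarrow> 'a set \<Rightarrow> bool" where
  "submanifold X A k N \<longleftrightarrow> N \<subseteq> topspace X \<and>
     (\<forall>z\<in>N. \<exists>c\<in>maximal_atlas X A. \<exists>L. z \<in> fst c \<and> subspace L \<and> dim L = k \<and>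
        snd c ` (N \<inter> fst c) = snd c ` fst c \<inter> L)"

text \<open>The tangent space of \<open>N\<close> at \<open>z\<close>: velocities at time 0 of smooth curves lying in \<open>N\<close>.\<close>

definition submanifold_tangent_space ::
    "'a topology \<Rightarrow> ('a, 'e::euclidean_space) chart set \<Rightarrow> 'a set \<Rightarrow> 'a \<Rightarrow> ('a, 'e) tvec set" where
  "submanifold_tangent_space X A N z = {v. \<exists>\<gamma> \<epsilon>. \<epsilon> > 0 \<and> \<gamma> (0::real) = z \<and>
     \<gamma> ` {-\<epsilon><..<\<epsilon>} \<subseteq> N \<and>
     smooth_map (top_of_set {-\<epsilon><..<\<epsilon>}) {({-\<epsilon><..<\<epsilon>}, id)} X A \<gamma> \<and>
     v = (\<lambda>c. if c \<in> A \<and> z \<in> fst c then vector_derivative (snd c \<circ> \<gamma>) (at 0) else 0)}"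

definition transverse_to_fiber ::
    "'a topology \<Rightarrow> ('a, 'e::euclidean_space) chart set \<Rightarrow>
     ('a \<times> ('a, 'e) tvec) set \<Rightarrow> 'a \<times> ('a, 'e) tvec \<Rightarrow> bool" where
  "transverse_to_fiber X A N z \<longleftrightarrow>
     submanifold_tangent_space (tangent_topology X A) (tangent_atlas X A) N z \<inter>
     {v \<in> tangent_space (tangent_atlas X A) z.
        differential (tangent_atlas X A) A fst z v = (\<lambda>_. 0)} = {\<lambda>_. 0}"


section \<open>Simple connectedness\<close>

text \<open>
  As \<^const>\<open>simply_connected\<close>, for abstract topologies: any two loops are freely homotopic.
  Constant loops are included, so this implies path connectedness.
\<close>

definition simply_connected_space :: "'a topology \<Rightarrow> bool" where
  "simply_connected_space X \<longleftrightarrow>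
     (\<forall>p q. pathin X p \<and> p 1 = p 0 \<and> pathin X q \<and> q 1 = q 0 \<longrightarrow>
        homotopic_with (\<lambda>r. r 1 = r 0) (top_of_set {0..1}) X p q)"

end

theory Submission
  imports Defs
begin

text \<open>
  By transversality the projection restricted to \<open>N\<close> is a local diffeomorphism onto open sets of
  \<open>M\<close>. Its image is open and compact, hence everything, and a local homeomorphism from a compact
  space is a covering, so loops and their free homotopies lift. A path in \<open>N\<close> between two points of
  one fibre projects to a loop which contracts in \<open>M\<close>; lifting the contraction shows that the two
  points coincide. So the projection is a bijection \<open>N \<rightarrow> M\<close>, and its inverse, which is locally a
  smooth section, is \<open>\<xi>\<close>.
\<close>

section \<open>Calculus of \<open>C\<^sup>k\<close> maps\<close>

text \<open>Transversality speaks about velocities of curves in \<open>N\<close>, while a local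
  section has to come out of the inverse function theorem. A slice chart is the bridge: followed by
  the projection, its parametrization of \<open>N\<close> is a map between open subsets of
  \<open>real ^ 'n\<close>, because \<open>N\<close> has the dimension of the base, and a kernel
  vector of its derivative would be the velocity of a curve in \<open>N\<close> tangent to a fibre.
  Two obstacles shape the rest. The local inverse must be smooth to all orders, so its derivative is
  written by Cramer's rule in terms of known entries and regularity is raised one order at a time.
  And a tangent vector is a family over all charts, with \<open>differential\<close> reading it in
  one chosen chart, so statements about a fixed chart are carried to the others by the chain rule.
  Compactness of \<open>N\<close> yields one neighbourhood of a base point carrying sections through
  all points above it; connectedness of \<open>N\<close> enters as path connectedness, available
  because \<open>N\<close> is locally the image of a ball.\<close>

lemma Ck_on_Suc:
  "Ck_on (Suc k) f S \<longleftrightarrow>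
     (\<forall>x\<in>S. f differentiable (at x)) \<and> (\<forall>v. Ck_on k (\<lambda>x. frechet_derivative f (at x) v) S)"
  by simp

lemma Ck_on_subset: "Ck_on k f S \<Longrightarrow> T \<subseteq> S \<Longrightarrow> Ck_on k f T"
proof (induction k arbitrary: f)
  case 0 then show ?case using continuous_on_subset by auto
next
  case (Suc k) then show ?case by (auto simp: Ck_on_Suc simp del: Ck_on.simps)
qed

text \<open>Continuity and derivatives at a point depend only on a neighbourhood, and the
  neighbourhoods supplied are open, so \<open>S\<close> itself may be arbitrary.\<close>

lemma Ck_on_local:
  "(\<And>x. x \<in> S \<Longrightarrow> \<exists>U. open U \<and> x \<in> U \<and> Ck_on k f U) \<Longrightarrow> Ck_on k f S"
proof (induction k arbitrary: f)
  case 0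
  then have "isCont f x" if "x \<in> S" for x
    using that by (metis Ck_on.simps(1) continuous_on_eq_continuous_at)
  then show ?case by (simp add: continuous_at_imp_continuous_on)
next
  case (Suc k)
  have "Ck_on k (\<lambda>x. frechet_derivative f (at x) v) S" for v
  proof (rule Suc.IH)
    fix x assume "x \<in> S"
    with Suc.prems show "\<exists>U. open U \<and> x \<in> U \<and> Ck_on k (\<lambda>x. frechet_derivative f (at x) v) U"
      by (fastforce simp: Ck_on_Suc simp del: Ck_on.simps)
  qed
  moreover have "f differentiable (at x)" if "x \<in> S" for x
    using Suc.prems[OF that] by (auto simp: Ck_on_Suc simp del: Ck_on.simps)
  ultimately show ?case by (auto simp: Ck_on_Suc simp del: Ck_on.simps)
qed

lemma Ck_on_cong_open:
  assumes "open S" "\<And>x. x \<in> S \<Longrightarrow> f x = g x" "Ck_on k f S"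
  shows "Ck_on k g S"
  using assms(2,3)
proof (induction k arbitrary: f g)
  case 0 then show ?case by (simp cong: continuous_on_cong)
next
  case (Suc k)
  have diff: "f differentiable (at x)" if "x \<in> S" for x
    using Suc.prems that by auto
  have eq: "frechet_derivative f (at x) = frechet_derivative g (at x)" if "x \<in> S" for x
    using frechet_derivative_transform_within_open[OF diff[OF that] assms(1) that] Suc.prems by auto
  have "g differentiable (at x)" if "x \<in> S" for x
    using diff[OF that] Suc.prems(1) assms(1) that
    by (meson differentiable_def has_derivative_transform_within_open)
  moreover have "Ck_on k (\<lambda>x. frechet_derivative g (at x) v) S" for v
    by (rule Suc.IH[where f = "\<lambda>x. frechet_derivative f (at x) v"]) (use eq Suc.prems in auto)
  ultimately show ?case by (auto simp: Ck_on_Suc simp del: Ck_on.simps)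
qed

text \<open>\<open>frechet_derivative\<close> is a choice term; by uniqueness of derivatives any
  explicit \<open>F\<close> found by a differentiation rule may take its place. The inductions below
  produce such an \<open>F\<close>.\<close>

lemma Ck_on_SucI:
  assumes "open S" "\<And>x. x \<in> S \<Longrightarrow> (f has_derivative F x) (at x)"
    "\<And>v. Ck_on k (\<lambda>x. F x v) S"
  shows "Ck_on (Suc k) f S"
  unfolding Ck_on_Suc
proof (intro conjI ballI allI)
  show "f differentiable (at x)" if "x \<in> S" for x
    using assms(2)[OF that] differentiable_def by blast
  show "Ck_on k (\<lambda>x. frechet_derivative f (at x) v) S" for v
    by (rule Ck_on_cong_open[OF assms(1) _ assms(3)[of v]])
      (use assms(2) frechet_derivative_at in metis)
qed

lemma Ck_on_has_derivative:
  "Ck_on (Suc k) f S \<Longrightarrow> x \<in> S \<Longrightarrow> (f has_derivative frechet_derivative f (at x)) (at x)"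
  by (simp add: frechet_derivative_works)

lemma Ck_on_derivative: "Ck_on (Suc k) f S \<Longrightarrow> Ck_on k (\<lambda>x. frechet_derivative f (at x) v) S"
  by simp

lemma Ck_on_Suc_imp: "Ck_on (Suc k) f S \<Longrightarrow> Ck_on k f S"
proof (induction k arbitrary: f)
  case 0
  then show ?case
    by (auto intro!: continuous_at_imp_continuous_on differentiable_imp_continuous_within)
next
  case (Suc k)
  then show ?case by (metis Ck_on_Suc)
qed

lemma Ck_on_continuous: "Ck_on k f S \<Longrightarrow> continuous_on S f"
  by (induction k) (use Ck_on_Suc_imp in force)+

lemma Ck_on_const: "open S \<Longrightarrow> Ck_on k (\<lambda>x. c) S"
proof (induction k arbitrary: c)
  case (Suc k) then show ?case by (intro Ck_on_SucI[where F = "\<lambda>_ _. 0"]) auto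
qed auto

lemma Ck_on_linear:
  assumes "open S" "bounded_linear L" "Ck_on k f S"
  shows "Ck_on k (\<lambda>x. L (f x)) S"
  using assms(3)
proof (induction k arbitrary: f)
  case 0 then show ?case using assms(2) by (simp add: bounded_linear.continuous_on)
next
  case (Suc k)
  show ?case
    by (rule Ck_on_SucI[OF assms(1) bounded_linear.has_derivative[OF assms(2)
          Ck_on_has_derivative[OF Suc.prems]]])
      (use Suc in auto)
qed

lemma Ck_on_add:
  assumes "open S" "Ck_on k f S" "Ck_on k g S"
  shows "Ck_on k (\<lambda>x. f x + g x) S"
  using assms(2,3)
proof (induction k arbitrary: f g)
  case 0 then show ?case by (simp add: continuous_on_add)
next
  case (Suc k)
  show ?case
    by (rule Ck_on_SucI[OF assms(1) has_derivative_add[OF Ck_on_has_derivative[OF Suc.prems(1)]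
          Ck_on_has_derivative[OF Suc.prems(2)]]])
      (use Suc in auto)
qed

lemma Ck_on_sum:
  assumes "open S" "\<And>i. i \<in> I \<Longrightarrow> Ck_on k (f i) S"
  shows "Ck_on k (\<lambda>x. \<Sum>i\<in>I. f i x) S"
  using assms(2)
  by (induction I rule: infinite_finite_induct) (auto intro: Ck_on_const Ck_on_add assms(1))

text \<open>By the product rule the derivative is a sum of two terms of the same bilinear shape,
  each pairing one factor with a derivative of the other; hence the induction over arbitrary
  \<open>f\<close> and \<open>g\<close>.\<close>

lemma Ck_on_bilinear:
  assumes "open S" "bounded_bilinear B" "Ck_on k f S" "Ck_on k g S"
  shows "Ck_on k (\<lambda>x. B (f x) (g x)) S"
  using assms(3,4)
proof (induction k arbitrary: f g)
  case 0 then show ?case using assms(2) by (simp add: bounded_bilinear.continuous_on)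
next
  case (Suc k)
  show ?case
    by (rule Ck_on_SucI[OF assms(1) bounded_bilinear.FDERIV[OF assms(2)
          Ck_on_has_derivative[OF Suc.prems(1)] Ck_on_has_derivative[OF Suc.prems(2)]]])
      (assumption | intro Ck_on_add[OF assms(1)] Suc.IH Ck_on_derivative Ck_on_Suc_imp[OF Suc.prems(1)]
        Ck_on_Suc_imp[OF Suc.prems(2)] Suc.prems)+
qed

lemmas Ck_on_mult = Ck_on_bilinear[OF _ bounded_bilinear_mult]
lemmas Ck_on_scaleR = Ck_on_bilinear[OF _ bounded_bilinear_scaleR]

lemma Ck_on_prod:
  fixes f :: "'i \<Rightarrow> 'e::real_normed_vector \<Rightarrow> real"
  assumes "open S" "\<And>i. i \<in> I \<Longrightarrow> Ck_on k (f i) S"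
  shows "Ck_on k (\<lambda>x. \<Prod>i\<in>I. f i x) S"
  using assms(2)
  by (induction I rule: infinite_finite_induct) (auto intro: Ck_on_const Ck_on_mult assms(1))

text \<open>The derivative of the reciprocal is a product of \<open>f'\<close> with two copies of
  the reciprocal itself; the induction hypothesis gives the lower order regularity of these, so
  \<open>f\<close> stays fixed.\<close>

lemma Ck_on_inverse:
  fixes f :: "'e::real_normed_vector \<Rightarrow> real"
  assumes "open S" "\<And>x. x \<in> S \<Longrightarrow> f x \<noteq> 0" "Ck_on k f S"
  shows "Ck_on k (\<lambda>x. inverse (f x)) S"
  using assms(3)
proof (induction k)
  case 0 then show ?case using assms(2) by (simp add: continuous_on_inverse)
next
  case (Suc k)
  have inv: "Ck_on k (\<lambda>x. inverse (f x)) S"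
    using Suc Ck_on_Suc_imp by blast
  show ?case
  proof (rule Ck_on_SucI[OF assms(1) Deriv.has_derivative_inverse[OF assms(2)
          Ck_on_has_derivative[OF Suc.prems]]])
    fix v
    have "Ck_on k (\<lambda>x. -1 * (inverse (f x) * frechet_derivative f (at x) v * inverse (f x))) S"
      by (intro Ck_on_mult[OF assms(1)] Ck_on_const[OF assms(1)] inv Ck_on_derivative Suc.prems)
    then show "Ck_on k (\<lambda>x. - (inverse (f x) * frechet_derivative f (at x) v * inverse (f x))) S"
      by simp
  qed auto
qed

lemma Ck_on_Pair:
  assumes "open S" "Ck_on k f S" "Ck_on k g S"
  shows "Ck_on k (\<lambda>x. (f x, g x)) S"
proof -
  have "bounded_linear (\<lambda>y::'b. (y, 0::'c))" "bounded_linear (\<lambda>y::'c. (0::'b, y))"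
    by (auto intro: bounded_linear_Pair bounded_linear_zero bounded_linear_ident)
  then have "Ck_on k (\<lambda>x. (f x, 0) + (0, g x)) S"
    by (intro Ck_on_add[OF assms(1)]) (auto intro: Ck_on_linear[OF assms(1)] assms)
  then show ?thesis by simp
qed

text \<open>\<open>Ck_on\<close> differentiates in fixed directions only. A direction that varies
  with the point becomes scalar coefficients times fixed basis directions.\<close>

lemma linear_basis_expansion:
  fixes L :: "'e::euclidean_space \<Rightarrow> 'f::real_normed_vector"
  assumes "linear L"
  shows "L v = (\<Sum>b\<in>Basis. (v \<bullet> b) *\<^sub>R L b)"
  by (metis (mono_tags, lifting) assms euclidean_representation linear_scale linear_sum sum.cong)

text \<open>The chain rule applies the derivative of \<open>g\<close> to a vector that moves with
  \<open>x\<close>. After expansion in the basis each summand is a coefficient of the derivative of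
  \<open>f\<close> times a fixed directional derivative of \<open>g\<close> composed with
  \<open>f\<close>, which is the induction hypothesis for another \<open>g\<close>.\<close>

lemma Ck_on_compose:
  fixes f :: "'d::real_normed_vector \<Rightarrow> 'e::euclidean_space" and g :: "'e \<Rightarrow> 'f::real_normed_vector"
  assumes "open S" "open T" "f ` S \<subseteq> T" "Ck_on k f S" "Ck_on k g T"
  shows "Ck_on k (\<lambda>x. g (f x)) S"
  using assms(4,5)
proof (induction k arbitrary: g)
  case 0 then show ?case using assms(3) by (auto intro: continuous_on_compose2)
next
  case (Suc k)
  note g = Ck_on_has_derivative[OF Suc.prems(2)] and f = Ck_on_has_derivative[OF Suc.prems(1)]
  have fT: "f x \<in> T" if "x \<in> S" for x using assms(3) that by auto
  show ?case
  proof (rule Ck_on_SucI[OF assms(1) has_derivative_compose[OF f g[OF fT]]])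
    fix v
    have "Ck_on k (\<lambda>x. \<Sum>b\<in>Basis. (frechet_derivative f (at x) v \<bullet> b) *\<^sub>R
        frechet_derivative g (at (f x)) b) S"
    proof (intro Ck_on_sum Ck_on_scaleR assms(1))
      fix b :: 'e
      show "Ck_on k (\<lambda>x. frechet_derivative f (at x) v \<bullet> b) S"
        by (rule Ck_on_linear[OF assms(1) bounded_linear_inner_left Ck_on_derivative])
          (rule Suc.prems)
      show "Ck_on k (\<lambda>x. frechet_derivative g (at (f x)) b) S"
        by (rule Suc.IH[OF Ck_on_Suc_imp[OF Suc.prems(1)] Ck_on_derivative[OF Suc.prems(2)]])
    qed
    then show "Ck_on k (\<lambda>x. frechet_derivative g (at (f x)) (frechet_derivative f (at x) v)) S"
    proof (rule Ck_on_cong_open[OF assms(1), rotated])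
      fix x assume "x \<in> S"
      then show "(\<Sum>b\<in>Basis. (frechet_derivative f (at x) v \<bullet> b) *\<^sub>R
          frechet_derivative g (at (f x)) b)
          = frechet_derivative g (at (f x)) (frechet_derivative f (at x) v)"
        using linear_basis_expansion[OF has_derivative_linear[OF g[OF fT]]] by metis
    qed
  qed auto
qed

section \<open>Determinants and smooth inverse functions\<close>

lemma Ck_on_vec:
  fixes f :: "'n::finite \<Rightarrow> 'e::real_normed_vector \<Rightarrow> real"
  assumes "open S" "\<And>i. Ck_on k (f i) S"
  shows "Ck_on k (\<lambda>x. \<chi> i. f i x) S"
proof -
  have "Ck_on k (\<lambda>x. \<Sum>i\<in>UNIV. f i x *\<^sub>R (axis i 1 :: real ^ 'n)) S"
    by (intro Ck_on_sum Ck_on_scaleR assms Ck_on_const)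
  moreover have "(\<Sum>i\<in>UNIV. f i x *\<^sub>R axis i 1) = (\<chi> i. f i x)" for x
    by (simp add: vec_eq_iff axis_def if_distrib cong: if_cong)
  ultimately show ?thesis by simp
qed

lemma Ck_on_det:
  fixes F :: "'e::real_normed_vector \<Rightarrow> real ^ 'n ^ 'n"
  assumes "open S" "\<And>i j. Ck_on k (\<lambda>x. F x $ i $ j) S"
  shows "Ck_on k (\<lambda>x. det (F x)) S"
  unfolding det_def
  by (intro Ck_on_sum Ck_on_mult Ck_on_prod Ck_on_const assms)

text \<open>Cramer's rule turns the derivative of the inverse into a rational function of the entries
  of the Jacobian.\<close>

lemma Ck_on_inverse_function:
  fixes h k :: "real ^ 'n \<Rightarrow> real ^ 'n"
  assumes "open U" "open V" "k ` V \<subseteq> U" "smooth_on h U"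
    and der: "\<And>y. y \<in> V \<Longrightarrow> (k has_derivative k' y) (at y)"
    and right: "\<And>y v. y \<in> V \<Longrightarrow> frechet_derivative h (at (k y)) (k' y v) = v"
  shows "smooth_on k V"
proof -
  define D where "D = (\<lambda>y. matrix (frechet_derivative h (at (k y))))"
  have hder: "(h has_derivative frechet_derivative h (at x)) (at x)" if "x \<in> U" for x
    using assms(4) Ck_on_has_derivative that unfolding smooth_on_def by blast
  have D: "D y *v v = frechet_derivative h (at (k y)) v" if "y \<in> V" for y v
  proof -
    have "k y \<in> U" using assms(3) that by auto
    then show ?thesis
      unfolding D_def using matrix_vector_mul(2)[OF has_derivative_linear[OF hder]] by metis
  qed
  \<comment> \<open>The identity \<open>right\<close> only gives surjectivity, which for a square
    matrix is invertibility.\<close>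
  have det: "det (D y) \<noteq> 0" if "y \<in> V" for y
  proof -
    have "surj ((*v) (D y))"
      using D[OF that] right[OF that] by (metis surjI)
    then have "invertible (D y)"
      by (simp add: invertible_right_inverse matrix_right_invertible_surjective)
    then show ?thesis
      by (simp add: invertible_det_nz)
  qed
  have cramer_k: "k' y v = (\<chi> i. det (\<chi> r c. if c = i then v $ r else D y $ r $ c) * inverse (det (D y)))"
    if "y \<in> V" for y v
  proof -
    have "D y *v k' y v = v"
      by (rule trans[OF D[OF that] right[OF that]])
    from this[unfolded cramer[OF det[OF that]]] show ?thesis
      unfolding divide_inverse .
  qed
  \<comment> \<open>Bootstrap: if \<open>k\<close> is of order \<open>j\<close>, so are the entries
    of \<open>D\<close>, being derivatives of \<open>h\<close> composed with \<open>k\<close>;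
    Cramer's formula then makes the derivative of \<open>k\<close> of order \<open>j\<close>, so
    \<open>k\<close> is of order \<open>Suc j\<close>.\<close>
  have "Ck_on j k V" for j
  proof (induction j)
    case 0
    then show ?case
      using der by (auto intro!: continuous_at_imp_continuous_on has_derivative_continuous)
  next
    case (Suc j)
    have entry: "Ck_on j (\<lambda>y. D y $ r $ c) V" for r c
    proof -
      have "Ck_on j (\<lambda>y. frechet_derivative h (at (k y)) (axis c 1)) V"
        by (rule Ck_on_compose[OF assms(2,1,3) Suc, of "\<lambda>x. frechet_derivative h (at x) (axis c 1)"])
          (use assms(4) Ck_on_derivative in \<open>blast dest: smooth_on_def[THEN iffD1]\<close>)
      then have "Ck_on j (\<lambda>y. frechet_derivative h (at (k y)) (axis c 1) $ r) V"
        by (rule Ck_on_linear[OF assms(2) bounded_linear_vec_nth])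
      then show ?thesis by (simp add: D_def matrix_def)
    qed
    show ?case
    proof (rule Ck_on_SucI[OF assms(2) der])
      fix v
      have "Ck_on j (\<lambda>y. \<chi> i. det (\<chi> r c. if c = i then v $ r else D y $ r $ c) * inverse (det (D y))) V"
      proof (intro Ck_on_vec Ck_on_mult Ck_on_inverse Ck_on_det assms(2) det entry)
        fix i r c
        show "Ck_on j (\<lambda>x. (\<chi> r c. if c = i then v $ r else D x $ r $ c) $ r $ c) V"
          using entry by (cases "c = i") (auto intro: Ck_on_const assms(2))
      qed
      then show "Ck_on j (\<lambda>y. k' y v) V"
        by (rule Ck_on_cong_open[OF assms(2), rotated]) (simp add: cramer_k)
    qed
  qed
  then show ?thesis by (simp add: smooth_on_def)
qed

section \<open>Smoothness: the same rules for all orders at once\<close>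

lemma smooth_on_has_derivative:
  "smooth_on f S \<Longrightarrow> x \<in> S \<Longrightarrow> (f has_derivative frechet_derivative f (at x)) (at x)"
  unfolding smooth_on_def using Ck_on_has_derivative by blast

lemma smooth_on_derivative:
  "smooth_on f S \<Longrightarrow> smooth_on (\<lambda>x. frechet_derivative f (at x) v) S"
  unfolding smooth_on_def using Ck_on_derivative by blast

lemma smooth_on_continuous: "smooth_on f S \<Longrightarrow> continuous_on S f"
  unfolding smooth_on_def using Ck_on_continuous by blast

lemma smooth_on_subset: "smooth_on f S \<Longrightarrow> T \<subseteq> S \<Longrightarrow> smooth_on f T"
  unfolding smooth_on_def using Ck_on_subset by blast

lemma smooth_on_local:
  "(\<And>x. x \<in> S \<Longrightarrow> \<exists>U. open U \<and> x \<in> U \<and> smooth_on f U) \<Longrightarrow> smooth_on f S"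
  unfolding smooth_on_def by (meson Ck_on_local)

lemma smooth_on_cong_open:
  "open S \<Longrightarrow> (\<And>x. x \<in> S \<Longrightarrow> f x = g x) \<Longrightarrow> smooth_on f S \<Longrightarrow> smooth_on g S"
  unfolding smooth_on_def using Ck_on_cong_open by blast

lemma smooth_on_compose:
  fixes f :: "'d::real_normed_vector \<Rightarrow> 'e::euclidean_space" and g :: "'e \<Rightarrow> 'f::real_normed_vector"
  shows "open S \<Longrightarrow> open T \<Longrightarrow> f ` S \<subseteq> T \<Longrightarrow> smooth_on f S \<Longrightarrow> smooth_on g T \<Longrightarrow>
    smooth_on (\<lambda>x. g (f x)) S"
  unfolding smooth_on_def using Ck_on_compose by blast

lemma smooth_on_linear: "open S \<Longrightarrow> bounded_linear L \<Longrightarrow> smooth_on f S \<Longrightarrow> smooth_on (\<lambda>x. L (f x)) S"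
  unfolding smooth_on_def using Ck_on_linear by blast

lemma smooth_on_ident: "open S \<Longrightarrow> smooth_on (\<lambda>x. x) S"
  unfolding smooth_on_def
proof
  fix k assume S: "open S"
  show "Ck_on k (\<lambda>x. x) S"
  proof (cases k)
    case (Suc j)
    then show ?thesis
      using Ck_on_SucI[OF S has_derivative_ident] Ck_on_const[OF S] by metis
  qed simp
qed

lemma smooth_on_affine: "open S \<Longrightarrow> bounded_linear L \<Longrightarrow> smooth_on (\<lambda>x. a + L x) S"
  using smooth_on_linear[OF _ _ smooth_on_ident, of S L] Ck_on_add[OF _ Ck_on_const]
  unfolding smooth_on_def by blast

text \<open>In equal dimensions an injective derivative has the inverse that
  \<open>inverse_function_theorem\<close> asks for; the local inverse obtained has a pointwise
  derivative, and \<open>Ck_on_inverse_function\<close> upgrades this to smoothness.\<close>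

lemma smooth_inverse_function:
  fixes h :: "real ^ 'n \<Rightarrow> real ^ 'n"
  assumes "open U" "x0 \<in> U" "smooth_on h U"
    and inj: "\<And>w. frechet_derivative h (at x0) w = 0 \<Longrightarrow> w = 0"
  obtains U' V k where "open U'" "U' \<subseteq> U" "x0 \<in> U'" "open V" "homeomorphism U' V h k" "smooth_on k V"
proof -
  define h' where "h' = (\<lambda>x. Blinfun (frechet_derivative h (at x)))"
  have hder: "(h has_derivative frechet_derivative h (at x)) (at x)" if "x \<in> U" for x
    using assms(3) that by (rule smooth_on_has_derivative)
  have h': "blinfun_apply (h' x) = frechet_derivative h (at x)" if "x \<in> U" for x
    unfolding h'_def using hder[OF that] has_derivative_bounded_linear
    by (intro bounded_linear_Blinfun_apply) blast
  \<comment> \<open>Continuity is meant in operator norm; in finite dimension it can be tested on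
    basis vectors, where it is continuity of directional derivatives.\<close>
  have cont: "continuous_on U h'"
  proof (rule continuous_on_blinfun_componentwise)
    fix i :: "real ^ 'n"
    show "continuous_on U (\<lambda>x. blinfun_apply (h' x) i)"
      using smooth_on_continuous[OF smooth_on_derivative[OF assms(3), of i]]
      by (simp add: h' cong: continuous_on_cong)
  qed
  have lin: "linear (frechet_derivative h (at x0))"
    using hder[OF assms(2)] by (rule has_derivative_linear)
  have "inj (frechet_derivative h (at x0))"
    using lin inj linear_injective_0 by blast
  then obtain g where g: "linear g" "g \<circ> frechet_derivative h (at x0) = id"
    using linear_injective_left_inverse[OF lin] by blast
  have "Blinfun g o\<^sub>L h' x0 = id_blinfun"
  proof (rule blinfun_eqI)
    fix i
    have "blinfun_apply (Blinfun g) = g"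
      using g(1) by (simp add: bounded_linear_Blinfun_apply linear_linear)
    then show "blinfun_apply (Blinfun g o\<^sub>L h' x0) i = blinfun_apply id_blinfun i"
      using g(2) by (simp add: h'[OF assms(2)]) (metis comp_apply id_apply)
  qed
  then obtain U' V k k' where *: "open U'" "U' \<subseteq> U" "x0 \<in> U'" "open V" "homeomorphism U' V h k"
      "\<And>y. y \<in> V \<Longrightarrow> (k has_derivative (k' y)) (at y)"
      "\<And>y. y \<in> V \<Longrightarrow> k' y = inv (blinfun_apply (h' (k y)))"
      "\<And>y. y \<in> V \<Longrightarrow> bij (blinfun_apply (h' (k y)))"
    using inverse_function_theorem[OF assms(1) _ cont assms(2), of h "Blinfun g"] hder h'
    by (metis (no_types, lifting))
  have kV: "k ` V \<subseteq> U"
    using *(2,5) unfolding homeomorphism_def by auto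
  have "smooth_on k V"
  proof (rule Ck_on_inverse_function[OF assms(1) *(4) kV assms(3) *(6)])
    fix y v assume y: "y \<in> V"
    then have "k y \<in> U" using kV by auto
    then show "frechet_derivative h (at (k y)) (k' y v) = v"
      using h'[of "k y"] *(7,8)[OF y] by (metis bij_inv_eq_iff)
  qed
  then show ?thesis using that * by blast
qed


section \<open>Local homeomorphisms from compact spaces\<close>

text \<open>Path components are open here, and the complement of one is a union of others, so each
  is clopen. This lets points of one fibre in the connected \<open>N\<close> be joined by a
  path.\<close>

lemma path_connected_space_if_locally:
  assumes "connected_space Y"
    and loc: "\<And>y. y \<in> topspace Y \<Longrightarrow> \<exists>W. openin Y W \<and> y \<in> W \<and> path_connectedin Y W"
  shows "path_connected_space Y"
proof -
  have comp_open: "openin Y (path_component_of_set Y x)" for x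
  proof (subst openin_subopen, clarify)
    fix y assume y: "path_component_of Y x y"
    then obtain W where W: "openin Y W" "y \<in> W" "path_connectedin Y W"
      using loc path_component_in_topspace by meson
    have "path_component_of Y x w" if "w \<in> W" for w
      using W y that path_component_of path_component_of_trans by metis
    then show "\<exists>W. openin Y W \<and> y \<in> W \<and> W \<subseteq> path_component_of_set Y x"
      using W by blast
  qed
  have "path_component_of_set Y x = topspace Y" if x: "x \<in> topspace Y" for x
  proof -
    have "topspace Y - path_component_of_set Y x = (\<Union>y\<in>topspace Y - path_component_of_set Y x. path_component_of_set Y y)"
      by (auto simp: path_component_of_refl dest: path_component_in_topspace)
        (metis path_component_of_sym path_component_of_trans)
    then have "openin Y (topspace Y - path_component_of_set Y x)"
      using comp_open by (metis (no_types, lifting) imageE openin_Union)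
    then have "closedin Y (path_component_of_set Y x)"
      by (simp add: closedin_def path_component_of_subset_topspace)
    then show ?thesis
      using assms(1) comp_open x unfolding connected_space_clopen_in
      by (metis empty_Collect_eq path_component_of_refl)
  qed
  then show ?thesis
    unfolding path_connected_space_iff_path_component by blast
qed

text \<open>The covering argument is purely topological and is kept free of charts. Local
  homeomorphy is phrased through local inverses: \<open>s\<close> inverts \<open>f\<close> on
  \<open>V\<close> and is continuous on the open image of \<open>V\<close>.\<close>

locale compact_local_homeo =
  fixes Y :: "'b topology" and X :: "'a topology" and f :: "'b \<Rightarrow> 'a"
  assumes compact: "compact_space Y"
    and Hausdorff_source: "Hausdorff_space Y"
    and Hausdorff_target: "Hausdorff_space X"
    and cont: "continuous_map Y X f"
    and local_section: "\<And>y. y \<in> topspace Y \<Longrightarrow>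
      \<exists>V s. openin Y V \<and> y \<in> V \<and> openin X (f ` V) \<and>
        continuous_map (subtopology X (f ` V)) Y s \<and> (\<forall>v\<in>V. s (f v) = v)"
begin

lemma closedin_image: "closedin Y C \<Longrightarrow> closedin X (f ` C)"
  using compact cont Hausdorff_target
  by (meson closedin_compact_space compactin_imp_closedin image_compactin)

lemma surjective:
  assumes "connected_space X" "topspace Y \<noteq> {}"
  shows "f ` topspace Y = topspace X"
proof -
  have "openin X (f ` topspace Y)"
  proof (subst openin_subopen, clarify)
    fix y assume "y \<in> topspace Y"
    then obtain V where "openin Y V" "y \<in> V" "openin X (f ` V)"
      using local_section by blast
    then show "\<exists>T. openin X T \<and> f y \<in> T \<and> T \<subseteq> f ` topspace Y"
      using openin_subset by (metis image_eqI image_mono)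
  qed
  moreover have "closedin X (f ` topspace Y)"
    by (rule closedin_image) simp
  ultimately show ?thesis
    using assms unfolding connected_space_clopen_in by blast
qed

text \<open>Over a small enough neighbourhood of \<open>x\<close> every preimage lies in one of the open sets chosen
  at the points of the fibre, because the rest of the source has a closed image.\<close>

lemma uniform_sections:
  assumes x: "x \<in> topspace X"
  obtains U where "openin X U" "x \<in> U"
    "\<And>y. y \<in> topspace Y \<Longrightarrow> f y \<in> U \<Longrightarrow>
      \<exists>s. continuous_map (subtopology X U) Y s \<and> (\<forall>u\<in>U. f (s u) = u) \<and> s (f y) = y"
proof -
  define F where "F = {y \<in> topspace Y. f y = x}"
  have "\<exists>V s. openin Y V \<and> y \<in> V \<and> openin X (f ` V) \<and>
        continuous_map (subtopology X (f ` V)) Y s \<and> (\<forall>v\<in>V. s (f v) = v)" if "y \<in> F" for y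
    using local_section that unfolding F_def by auto
  then obtain V s where V: "\<And>y. y \<in> F \<Longrightarrow> openin Y (V y)" "\<And>y. y \<in> F \<Longrightarrow> y \<in> V y"
      "\<And>y. y \<in> F \<Longrightarrow> openin X (f ` V y)"
      "\<And>y. y \<in> F \<Longrightarrow> continuous_map (subtopology X (f ` V y)) Y (s y)"
      "\<And>y v. y \<in> F \<Longrightarrow> v \<in> V y \<Longrightarrow> s y (f v) = v"
    by metis
  have "closedin X {x}"
    using x Hausdorff_target by (simp add: closedin_Hausdorff_singleton)
  then have "closedin Y F"
    using closedin_continuous_map_preimage[OF cont, of "{x}"] unfolding F_def by simp
  then have "compactin Y F"
    using compact closedin_compact_space by blast
  then obtain \<F> where \<F>: "finite \<F>" "\<F> \<subseteq> V ` F" "F \<subseteq> \<Union>\<F>"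
    unfolding compactin_def using V(1,2) by (smt (verit) UN_I imageE subsetI)
  then obtain K where K: "finite K" "K \<subseteq> F" "F \<subseteq> (\<Union>y\<in>K. V y)"
    by (metis finite_subset_image)
  define C where "C = topspace Y - (\<Union>y\<in>K. V y)"
  have "closedin Y C"
    unfolding C_def using V(1) K by (intro closedin_diff) auto
  then have clC: "closedin X (f ` C)" by (rule closedin_image)
  \<comment> \<open>Deleting the image of \<open>C\<close> forces every point over \<open>U\<close>
    into some \<open>V a\<close> with \<open>a \<in> K\<close>; intersecting the images makes the
    section of each such \<open>a\<close> defined on all of \<open>U\<close>. The factor
    \<open>topspace X\<close> covers an empty fibre: then \<open>K\<close> is empty and the bare
    intersection would be the whole type.\<close>
  define U where "U = (topspace X - f ` C) \<inter> (topspace X \<inter> (\<Inter>y\<in>K. f ` V y))"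
  show ?thesis
  proof
    have "openin X (topspace X \<inter> (\<Inter>y\<in>K. f ` V y))"
      using openin_INT[OF K(1), of X "\<lambda>y. f ` V y"] V(3) K(2) by (auto simp: Int_commute)
    then show "openin X U"
      unfolding U_def by (intro openin_Int[OF openin_diff[OF openin_topspace clC]])
    have "x \<notin> f ` C"
      using K(3) unfolding C_def F_def by auto
    moreover have "x \<in> f ` V y" if "y \<in> K" for y
    proof -
      have "y \<in> F" using that K by auto
      then show ?thesis using V(2) unfolding F_def by auto
    qed
    ultimately show "x \<in> U"
      unfolding U_def using x by auto
    fix y assume y: "y \<in> topspace Y" "f y \<in> U"
    then obtain a where a: "a \<in> K" "y \<in> V a"
      unfolding U_def C_def by auto
    then have aF: "a \<in> F" using K by auto
    have sub: "U \<subseteq> f ` V a"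
      unfolding U_def using a by auto
    then have "continuous_map (subtopology X U) Y (s a)"
      using V(4)[OF aF] continuous_map_from_subtopology_mono by blast
    moreover have "f (s a u) = u" if "u \<in> U" for u
      using that sub V(5)[OF aF] by fastforce
    ultimately show "\<exists>s. continuous_map (subtopology X U) Y s \<and> (\<forall>u\<in>U. f (s u) = u) \<and> s (f y) = y"
      using V(5)[OF aF a(2)] by blast
  qed
qed

text \<open>The set of agreement is closed because \<open>Y\<close> is Hausdorff, and open because
  near a common value both maps are recovered from their common projection by one local inverse
  \<open>s\<close>.\<close>

lemma unique_lift:
  assumes "connected_space Z" "continuous_map Z Y G" "continuous_map Z Y H"
    and "\<And>z. z \<in> topspace Z \<Longrightarrow> f (G z) = f (H z)"
    and "a \<in> topspace Z" "G a = H a" "z \<in> topspace Z"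
  shows "G z = H z"
proof -
  let ?E = "{z \<in> topspace Z. G z = H z}"
  have "closedin Z ?E"
    using closedin_continuous_maps_eq[OF Hausdorff_source assms(2,3)] .
  moreover have "openin Z ?E"
  proof (subst openin_subopen, clarify)
    fix z assume z: "z \<in> topspace Z" "G z = H z"
    then have "G z \<in> topspace Y"
      using assms(2) continuous_map_image_subset_topspace by fastforce
    then obtain V s where V: "openin Y V" "G z \<in> V" "\<forall>v\<in>V. s (f v) = v"
      using local_section by blast
    let ?W = "{z \<in> topspace Z. G z \<in> V} \<inter> {z \<in> topspace Z. H z \<in> V}"
    have "openin Z ?W"
      using assms(2,3) V(1) by (intro openin_Int openin_continuous_map_preimage)
    moreover have "?W \<subseteq> ?E"
    proof clarify
      fix w assume "w \<in> topspace Z" "G w \<in> V" "H w \<in> V"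
      then show "G w = H w" using V(3) assms(4) by metis
    qed
    ultimately show "\<exists>T. openin Z T \<and> z \<in> T \<and> T \<subseteq> ?E"
      using z V by (intro exI[of _ ?W]) auto
  qed
  ultimately show ?thesis
    using assms unfolding connected_space_clopen_in by blast
qed

text \<open>A lift is demanded through every point over every \<open>q \<in> R\<close>, not over one
  base point only: gluing prescribes the value at a point of the overlap.\<close>

definition liftable :: "('m::metric_space \<Rightarrow> 'a) \<Rightarrow> 'm set \<Rightarrow> bool" where
  "liftable H R \<longleftrightarrow> (\<forall>q\<in>R. \<forall>y\<in>topspace Y. f y = H q \<longrightarrow>
     (\<exists>G. continuous_map (top_of_set R) Y G \<and> (\<forall>r\<in>R. f (G r) = H r) \<and> G q = y))"

text \<open>The second lift is started at the value of the first one at a common point; on the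
  connected overlap the two agree by uniqueness, and they paste because both pieces are
  closed.\<close>

lemma liftable_Un:
  assumes "liftable H R" "liftable H S" "closed R" "closed S" "connected (R \<inter> S)" "R \<inter> S \<noteq> {}"
  shows "liftable H (R \<union> S)"
proof -
  \<comment> \<open>Stated for arbitrary sets, since a base point in \<open>S\<close> is the same
    case with the roles exchanged.\<close>
  have half: "\<exists>G. continuous_map (top_of_set (R \<union> S)) Y G \<and> (\<forall>r\<in>R \<union> S. f (G r) = H r) \<and> G q = y"
    if RS: "liftable H R" "liftable H S" "closed R" "closed S" "connected (R \<inter> S)" "R \<inter> S \<noteq> {}"
      and q: "q \<in> R" "y \<in> topspace Y" "f y = H q" for R S q y
  proof -
    obtain G where G: "continuous_map (top_of_set R) Y G" "\<forall>r\<in>R. f (G r) = H r" "G q = y"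
      using RS(1) q unfolding liftable_def by blast
    obtain q' where q': "q' \<in> R" "q' \<in> S" using RS(6) by auto
    have "G q' \<in> topspace Y"
      using G(1) q'(1) continuous_map_image_subset_topspace by fastforce
    then obtain G' where G': "continuous_map (top_of_set S) Y G'" "\<forall>r\<in>S. f (G' r) = H r" "G' q' = G q'"
      using RS(2) q' G(2) unfolding liftable_def by metis
    have agree: "G r = G' r" if "r \<in> R \<inter> S" for r
    proof (rule unique_lift[of "top_of_set (R \<inter> S)" _ _ q'])
      show "connected_space (top_of_set (R \<inter> S))"
        using \<open>connected (R \<inter> S)\<close> by (simp add: connected_space_subtopology)
      show "continuous_map (top_of_set (R \<inter> S)) Y G" "continuous_map (top_of_set (R \<inter> S)) Y G'"
        using G(1) G'(1) continuous_map_from_subtopology_mono by (metis inf_le1 inf_le2)+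
    qed (use G G' q' that in auto)
    let ?K = "\<lambda>r. if r \<in> R then G r else G' r"
    have "continuous_map (top_of_set (R \<union> S)) Y ?K"
    proof (rule pasting_lemma_closed[where I = "{True, False}" and T = "\<lambda>b. if b then R else S"
          and f = "\<lambda>b. if b then G else G'"])
      show "closedin (top_of_set (R \<union> S)) (if i then R else S)" for i
        using RS by (auto intro: closed_subset)
      show "continuous_map (subtopology (top_of_set (R \<union> S)) (if i then R else S)) Y (if i then G else G')" for i
        using G(1) G'(1) by (auto simp: subtopology_subtopology inf.absorb2)
    qed (use agree in \<open>auto split: if_splits\<close>)
    then show ?thesis
      using G(2,3) G'(2) q(1) by (intro exI[of _ ?K]) auto
  qed
  show ?thesis
    unfolding liftable_def
  proof (intro ballI impI)
    fix q y assume "q \<in> R \<union> S" "y \<in> topspace Y" "f y = H q"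
    then show "\<exists>G. continuous_map (top_of_set (R \<union> S)) Y G \<and> (\<forall>r\<in>R \<union> S. f (G r) = H r) \<and> G q = y"
      using half[of R S q y] half[of S R q y] assms by (auto simp: Un_commute Int_commute)
  qed
qed

text \<open>Pulling back the neighbourhoods of \<open>uniform_sections\<close> gives an open cover
  of \<open>Q\<close>. A set below its Lebesgue number is mapped into one of them, and
  \<open>H\<close> followed by a section there is the lift.\<close>

lemma liftable_small:
  assumes "compact Q" "continuous_map (top_of_set Q) X H"
  obtains \<delta> where "\<delta> > 0" "\<And>T. T \<subseteq> Q \<Longrightarrow> diameter T < \<delta> \<Longrightarrow> liftable H T"
proof -
  let ?good = "\<lambda>q B U. open B \<and> q \<in> B \<and> openin X U \<and> (\<forall>r\<in>Q \<inter> B. H r \<in> U) \<and>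
      (\<forall>y\<in>topspace Y. f y \<in> U \<longrightarrow>
        (\<exists>s. continuous_map (subtopology X U) Y s \<and> (\<forall>u\<in>U. f (s u) = u) \<and> s (f y) = y))"
  have "\<exists>BU. ?good q (fst BU) (snd BU)"
    if "q \<in> Q" for q
  proof -
    have "H q \<in> topspace X"
      using assms(2) that continuous_map_image_subset_topspace by fastforce
    then obtain U where U: "openin X U" "H q \<in> U" "\<And>y. y \<in> topspace Y \<Longrightarrow> f y \<in> U \<Longrightarrow>
      \<exists>s. continuous_map (subtopology X U) Y s \<and> (\<forall>u\<in>U. f (s u) = u) \<and> s (f y) = y"
      using uniform_sections by metis
    have "openin (top_of_set Q) {r \<in> Q. H r \<in> U}"
      using openin_continuous_map_preimage[OF assms(2) U(1)] by simp
    then obtain B where "open B" "{r \<in> Q. H r \<in> U} = Q \<inter> B"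
      by (auto simp: openin_open)
    then show ?thesis
      using U that by (intro exI[of _ "(B, U)"]) auto
  qed
  then obtain BU where BU: "\<forall>q\<in>Q. ?good q (fst (BU q)) (snd (BU q))"
    using bchoice[of Q "\<lambda>q BU. ?good q (fst BU) (snd BU)"] by blast
  define B where "B = (\<lambda>q. fst (BU q))"
  define U where "U = (\<lambda>q. snd (BU q))"
  from BU have good: "?good q (B q) (U q)" if "q \<in> Q" for q
    using that unfolding B_def U_def by blast
  note B = good[THEN conjunct1] good[THEN conjunct2, THEN conjunct1]
  have HU: "H r \<in> U q" if "q \<in> Q" "r \<in> Q \<inter> B q" for q r
    using good[OF that(1)] that(2) by blast
  have sect: "\<exists>s. continuous_map (subtopology X (U q)) Y s \<and> (\<forall>u\<in>U q. f (s u) = u) \<and> s (f y) = y"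
    if "q \<in> Q" "y \<in> topspace Y" "f y \<in> U q" for q y
    using good[OF that(1)] that(2,3) by blast
  show ?thesis
  proof (cases "Q = {}")
    case True
    \<comment> \<open>The Lebesgue number lemma asks for a nonempty cover; over the empty set any
      bound works.\<close>
    then show ?thesis using that[of 1] by (auto simp: liftable_def)
  next
    case False
    obtain \<delta> where \<delta>: "0 < \<delta>" "\<And>T. T \<subseteq> Q \<Longrightarrow> diameter T < \<delta> \<Longrightarrow> \<exists>C\<in>B ` Q. T \<subseteq> C"
      by (rule Lebesgue_number_lemma[OF assms(1), of "B ` Q"]) (use False B in auto)
    show ?thesis
    proof (rule that[OF \<delta>(1)])
      fix T assume T: "T \<subseteq> Q" "diameter T < \<delta>"
      then obtain q where q: "q \<in> Q" "T \<subseteq> B q" using \<delta>(2) by blast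
      show "liftable H T"
        unfolding liftable_def
      proof (intro ballI impI)
        fix t y assume t: "t \<in> T" "y \<in> topspace Y" "f y = H t"
        have HT: "H r \<in> U q" if "r \<in> T" for r
          using HU[OF q(1)] that q(2) T(1) by blast
        then obtain s where s: "continuous_map (subtopology X (U q)) Y s" "\<forall>u\<in>U q. f (s u) = u" "s (f y) = y"
          using sect[OF q(1) t(2)] t by auto
        have "continuous_map (top_of_set T) (subtopology X (U q)) H"
          using continuous_map_from_subtopology_mono[OF assms(2) T(1)] HT
          by (auto simp: continuous_map_in_subtopology)
        then have "continuous_map (top_of_set T) Y (s \<circ> H)"
          using s(1) continuous_map_compose by blast
        then show "\<exists>G. continuous_map (top_of_set T) Y G \<and> (\<forall>r\<in>T. f (G r) = H r) \<and> G t = y"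
          using s t HT by (intro exI[of _ "s \<circ> H"]) auto
      qed
    qed
  qed
qed

lemma diameter_rectangle:
  fixes a b c d :: real
  assumes "a \<le> b" "c \<le> d"
  shows "diameter (cbox (a, c) (b, d)) \<le> (b - a) + (d - c)"
proof (rule diameter_le)
  show "cbox (a, c) (b, d) \<noteq> {} \<or> 0 \<le> b - a + (d - c)" using assms by auto
  fix p q assume "p \<in> cbox (a, c) (b, d)" "q \<in> cbox (a, c) (b, d)"
  then have "norm (fst p - fst q) \<le> b - a" "norm (snd p - snd q) \<le> d - c"
    by (auto simp: cbox_Pair_eq)
  then show "norm (p - q) \<le> b - a + (d - c)"
    using norm_Pair_le[of "fst p - fst q" "snd p - snd q"] by (simp add: minus_prod_def)
qed

text \<open>Bisection in both directions leads to pieces within reach of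
  \<open>liftable_small\<close>; neighbouring pieces meet in an edge, a degenerate rectangle, so
  \<open>liftable_Un\<close> applies at every stage.\<close>

lemma liftable_rectangle:
  fixes H :: "real \<times> real \<Rightarrow> 'a" and a b c d :: real
  assumes "a \<le> b" "c \<le> d" "continuous_map (top_of_set (cbox (a, c) (b, d))) X H"
  shows "liftable H (cbox (a, c) (b, d))"
proof -
  let ?Q = "cbox (a, c) (b, d)"
  obtain \<delta> where \<delta>: "\<delta> > 0" "\<And>T. T \<subseteq> ?Q \<Longrightarrow> diameter T < \<delta> \<Longrightarrow> liftable H T"
    using liftable_small[OF compact_cbox assms(3)] by blast
  have conn: "connected (cbox x y :: (real \<times> real) set)" for x y
    by (simp add: convex_box(1) convex_connected)
  \<comment> \<open>Sides of length at most \<open>\<delta> / 3\<close> give diameter at most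
    \<open>2 * \<delta> / 3 < \<delta>\<close>; \<open>k\<close> counts the halvings still to be
    made.\<close>
  have "liftable H (cbox (a', c') (b', d'))"
    if "a' \<le> b'" "c' \<le> d'" "cbox (a', c') (b', d') \<subseteq> ?Q"
      "b' - a' \<le> 2 ^ k * (\<delta> / 3)" "d' - c' \<le> 2 ^ k * (\<delta> / 3)" for k and a' b' c' d' :: real
    using that
  proof (induction k arbitrary: a' b' c' d')
    case 0
    then show ?case
      using \<delta> diameter_rectangle[of a' b' c' d'] by (intro \<delta>(2)) auto
  next
    case (Suc k)
    \<comment> \<open>A strip of already halved height is cut at the middle of its width; two such
      strips are stacked afterwards.\<close>
    have row: "liftable H (cbox (a', u) (b', v))"
      if uv: "u \<le> v" "c' \<le> u" "v \<le> d'" "v - u \<le> 2 ^ k * (\<delta> / 3)" for u v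
    proof -
      let ?m = "(a' + b') / 2"
      have m: "a' \<le> ?m" "?m \<le> b'" "?m - a' \<le> 2 ^ k * (\<delta> / 3)" "b' - ?m \<le> 2 ^ k * (\<delta> / 3)"
        using Suc.prems(1,4) by (auto simp: field_simps)
      have eq: "cbox (a', u) (b', v) = cbox (a', u) (?m, v) \<union> cbox (?m, u) (b', v)"
        using m(1,2) by (auto simp: cbox_Pair_eq)
      have int: "cbox (a', u) (?m, v) \<inter> cbox (?m, u) (b', v) = cbox (?m, u) (?m, v)"
        using m(1,2) by (auto simp: cbox_Pair_eq)
      have "cbox (a', u) (b', v) \<subseteq> ?Q"
        using uv by (intro subset_trans[OF _ Suc.prems(3)]) (auto simp: cbox_Pair_eq)
      then have sub: "cbox (a', u) (?m, v) \<subseteq> ?Q" "cbox (?m, u) (b', v) \<subseteq> ?Q"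
        unfolding eq by blast+
      have ne: "cbox (?m, u) (?m, v) \<noteq> {}"
        using uv(1) by (auto simp: cbox_Pair_eq)
      show ?thesis
        unfolding eq
        by (intro liftable_Un Suc.IH[OF m(1) uv(1) sub(1) m(3) uv(4)]
            Suc.IH[OF m(2) uv(1) sub(2) m(4) uv(4)] closed_cbox) (simp_all only: int conn ne simp_thms)
    qed
    let ?m = "(c' + d') / 2"
    have m: "c' \<le> ?m" "?m \<le> d'" "?m - c' \<le> 2 ^ k * (\<delta> / 3)" "d' - ?m \<le> 2 ^ k * (\<delta> / 3)"
      using Suc.prems(2,5) by (auto simp: field_simps)
    have eq: "cbox (a', c') (b', d') = cbox (a', c') (b', ?m) \<union> cbox (a', ?m) (b', d')"
      using m(1,2) by (auto simp: cbox_Pair_eq)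
    have int: "cbox (a', c') (b', ?m) \<inter> cbox (a', ?m) (b', d') = cbox (a', ?m) (b', ?m)"
      using m(1,2) by (auto simp: cbox_Pair_eq)
    have ne: "cbox (a', ?m) (b', ?m) \<noteq> {}"
      using Suc.prems(1) by (auto simp: cbox_Pair_eq)
    show ?case
      unfolding eq
      by (intro liftable_Un row[OF m(1) order_refl m(2,3)] row[OF m(2) m(1) order_refl m(4)] closed_cbox)
        (simp_all only: int conn ne simp_thms)
  qed
  moreover obtain k where "max (b - a) (d - c) / (\<delta> / 3) < 2 ^ k"
    using real_arch_pow[of 2] by auto
  then have "b - a \<le> 2 ^ k * (\<delta> / 3)" "d - c \<le> 2 ^ k * (\<delta> / 3)"
    using \<delta>(1) by (auto simp: divide_simps max_less_iff_conj max_mult_distrib_right)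
  ultimately show ?thesis using assms by blast
qed

text \<open>A path joining two points of a fibre lies over a loop; a free homotopy through loops to a
  constant loop lifts, and its two vertical sides are lifts of one path that agree at the end.\<close>

lemma injective:
  assumes "path_connected_space Y" "simply_connected_space X"
  shows "inj_on f (topspace Y)"
proof (rule inj_onI)
  fix y z assume yz: "y \<in> topspace Y" "z \<in> topspace Y" "f y = f z"
  obtain \<gamma> where \<gamma>: "pathin Y \<gamma>" "\<gamma> 0 = y" "\<gamma> 1 = z"
    using assms(1) yz unfolding path_connected_space_def by blast
  have "f y \<in> topspace X"
    using cont yz continuous_map_image_subset_topspace by fastforce
  \<comment> \<open>The constant loop at \<open>f y\<close> is among the loops of the definition. In
    \<open>H (s, t)\<close> the first argument is the deformation parameter, the second the loop
    parameter.\<close>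
  then have "homotopic_with (\<lambda>r. r 1 = r 0) (top_of_set {0..1}) X (f \<circ> \<gamma>) (\<lambda>_. f y)"
    using assms(2) \<gamma> yz(3) pathin_compose[OF \<gamma>(1) cont]
    unfolding simply_connected_space_def by simp
  then obtain H where H: "continuous_map (prod_topology (top_of_set {0..1::real}) (top_of_set {0..1::real})) X H"
      "\<And>t. H (0, t) = f (\<gamma> t)" "\<And>t. H (1, t) = f y" "\<And>s. s \<in> {0..1} \<Longrightarrow> H (s, 1) = H (s, 0)"
    unfolding homotopic_with_def by auto
  let ?Q = "cbox (0, 0) (1, 1) :: (real \<times> real) set"
  have Q: "prod_topology (top_of_set {0..1::real}) (top_of_set {0..1::real}) = top_of_set ?Q"
    by (simp add: cbox_Pair_eq flip: subtopology_Times)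
  have "liftable H ?Q"
    using H(1) unfolding Q by (intro liftable_rectangle) auto
  moreover have "(0, 0) \<in> ?Q" "f y = H (0, 0)"
    using H(2)[of 0] \<gamma>(2) by (auto simp: cbox_Pair_eq)
  ultimately obtain G where G: "continuous_map (top_of_set ?Q) Y G" "\<forall>r\<in>?Q. f (G r) = H r" "G (0, 0) = y"
    using yz(1) unfolding liftable_def by blast
  have I: "connected_space (top_of_set {0..1::real})"
    by (simp add: connected_space_subtopology)
  have along: "continuous_map (top_of_set {0..1}) Y (\<lambda>t. G (p t))"
    if "continuous_on {0..1} p" "p ` {0..1} \<subseteq> ?Q" for p :: "real \<Rightarrow> real \<times> real"
  proof -
    have "continuous_map (top_of_set {0..1}) (top_of_set ?Q) p"
      using that by auto
    then show ?thesis
      using continuous_map_compose[OF _ G(1)] unfolding o_def by blast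
  qed
  \<comment> \<open>On the edge \<open>s = 0\<close> the path \<open>\<gamma>\<close> is itself a
    lift with the same start, so \<open>G (0, 1)\<close> is \<open>z\<close>.\<close>
  have start: "G (0, t) = \<gamma> t" if "t \<in> {0..1}" for t
  proof (rule unique_lift[OF I, of _ _ 0])
    show "continuous_map (top_of_set {0..1}) Y (\<lambda>t. G (0, t))"
      by (rule along) (auto intro!: continuous_intros simp: cbox_Pair_eq)
    show "continuous_map (top_of_set {0..1}) Y \<gamma>"
      using \<gamma>(1) by (simp add: pathin_def)
  qed (use G H \<gamma> that in \<open>auto simp: cbox_Pair_eq\<close>)
  \<comment> \<open>On the edge \<open>s = 1\<close> the loop is constant, hence so is its lift;
    this gives the two remaining edges their common end.\<close>
  have stop: "G (1, t) = G (1, 0)" if "t \<in> {0..1}" for t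
  proof (rule unique_lift[OF I, of "\<lambda>t. G (1, t)" "\<lambda>t. G (1, 0)" 0])
    show "continuous_map (top_of_set {0..1}) Y (\<lambda>t. G (1, t))"
      by (rule along) (auto intro!: continuous_intros simp: cbox_Pair_eq)
    show "continuous_map (top_of_set {0..1::real}) Y (\<lambda>t. G (1, 0))"
      by (rule along) (auto simp: cbox_Pair_eq)
  qed (use G H that in \<open>auto simp: cbox_Pair_eq\<close>)
  have "G (0, 0) = G (0, 1)"
  proof (rule unique_lift[OF I, of "\<lambda>s. G (s, 0)" "\<lambda>s. G (s, 1)" 1])
    show "continuous_map (top_of_set {0..1}) Y (\<lambda>s. G (s, 0))"
         "continuous_map (top_of_set {0..1}) Y (\<lambda>s. G (s, 1))"
      by (rule along; auto intro!: continuous_intros simp: cbox_Pair_eq)+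
    show "G (1, 0) = G (1, 1)"
      using stop[of 1] by simp
  qed (use G(2) H(4) in \<open>auto simp: cbox_Pair_eq\<close>)
  then show "y = z"
    using start[of 0] start[of 1] \<gamma> by simp
qed

end


section \<open>Charts and the tangent bundle\<close>

lemma is_chart_inj: "is_chart Y c \<Longrightarrow> inj_on (snd c) (fst c)"
  unfolding is_chart_def
  using homeomorphic_imp_injective_map[of "subtopology Y (fst c)"] openin_subset[of Y "fst c"]
  by (metis inf.absorb2 topspace_subtopology)

lemma is_chart_openin: "is_chart Y c \<Longrightarrow> openin Y (fst c)"
  by (simp add: is_chart_def)

lemma is_chart_open: "is_chart Y c \<Longrightarrow> open (snd c ` fst c)"
  by (simp add: is_chart_def)

lemma inv_into_chart:
  "inj_on (snd c) (fst c) \<Longrightarrow> p \<in> fst c \<Longrightarrow> inv_into (fst c) (snd c) (snd c p) = p"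
  by (rule inv_into_f_f)

lemma is_chart_continuous:
  "is_chart Y c \<Longrightarrow> continuous_map (subtopology Y (fst c)) euclidean (snd c)"
  unfolding is_chart_def homeomorphic_eq_everything_map
  by (simp add: continuous_map_in_subtopology)

lemma is_chart_open_preimage:
  assumes "is_chart Y c" "open W"
  shows "openin Y {p \<in> fst c. snd c p \<in> W}"
proof -
  have "openin (subtopology Y (fst c)) {p \<in> topspace (subtopology Y (fst c)). snd c p \<in> W}"
    by (rule openin_continuous_map_preimage[OF is_chart_continuous[OF assms(1)]]) (use assms(2) in simp)
  moreover have "{p \<in> topspace (subtopology Y (fst c)). snd c p \<in> W} = {p \<in> fst c. snd c p \<in> W}"
    using openin_subset[OF is_chart_openin[OF assms(1)]] by auto
  ultimately show ?thesis
    using openin_open_subtopology[OF is_chart_openin[OF assms(1)]] by metis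
qed

lemma is_chart_open_image:
  assumes "is_chart Y c" "openin Y W"
  shows "open (snd c ` (fst c \<inter> W))"
proof -
  have "open_map (subtopology Y (fst c)) (top_of_set (snd c ` fst c)) (snd c)"
    using assms(1) by (simp add: is_chart_def homeomorphic_eq_everything_map)
  moreover have "openin (subtopology Y (fst c)) (fst c \<inter> W)"
    using assms(2) by (metis openin_subtopology_Int2)
  ultimately have "openin (top_of_set (snd c ` fst c)) (snd c ` (fst c \<inter> W))"
    unfolding open_map_def by blast
  then show ?thesis
    using is_chart_open[OF assms(1)] by (metis openin_open_trans)
qed

lemma is_chart_continuous_inv:
  assumes "is_chart Y c"
  shows "continuous_map (top_of_set (snd c ` fst c)) Y (inv_into (fst c) (snd c))"
  unfolding continuous_map_def
proof (intro conjI allI impI)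
  note inj = is_chart_inj[OF assms]
  show "inv_into (fst c) (snd c) \<in> topspace (top_of_set (snd c ` fst c)) \<rightarrow> topspace Y"
  proof
    fix x assume "x \<in> topspace (top_of_set (snd c ` fst c))"
    then have "inv_into (fst c) (snd c) x \<in> fst c"
      by (simp add: inv_into_into)
    then show "inv_into (fst c) (snd c) x \<in> topspace Y"
      using openin_subset[OF is_chart_openin[OF assms]] by blast
  qed
  fix W assume "openin Y W"
  then have "open (snd c ` (fst c \<inter> W))" by (rule is_chart_open_image[OF assms])
  moreover have "{x \<in> topspace (top_of_set (snd c ` fst c)). inv_into (fst c) (snd c) x \<in> W}
      = snd c ` (fst c \<inter> W)"
  proof (intro set_eqI iffI)
    fix x assume "x \<in> snd c ` (fst c \<inter> W)"
    then obtain p where "p \<in> fst c" "p \<in> W" "x = snd c p" by blast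
    then show "x \<in> {x \<in> topspace (top_of_set (snd c ` fst c)). inv_into (fst c) (snd c) x \<in> W}"
      using inv_into_chart[OF inj] by simp
  next
    fix x assume "x \<in> {x \<in> topspace (top_of_set (snd c ` fst c)). inv_into (fst c) (snd c) x \<in> W}"
    then obtain p where p: "p \<in> fst c" "x = snd c p" "inv_into (fst c) (snd c) x \<in> W" by auto
    then have "p \<in> W" using inv_into_chart[OF inj p(1)] by simp
    then show "x \<in> snd c ` (fst c \<inter> W)" using p by blast
  qed
  ultimately show "openin (top_of_set (snd c ` fst c))
      {x \<in> topspace (top_of_set (snd c ` fst c)). inv_into (fst c) (snd c) x \<in> W}"
    by (metis Int_lower1 image_mono open_openin_trans open_subset)
qed

lemma local_rep_apply:
  "inj_on (snd c) (fst c) \<Longrightarrow> p \<in> fst c \<Longrightarrow> local_rep c d f (snd c p) = snd d (f p)"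
  by (simp add: local_rep_def)

text \<open>Outside the domain of \<open>d\<close> the values of the charts are junk, but only the behaviour near
  \<open>p\<close> matters; the chart \<open>e\<close> on the target side is just a map.\<close>

lemma local_rep_chain:
  assumes "inj_on (snd c) (fst c)" "inj_on (snd d) (fst d)" "open (snd c ` (fst c \<inter> fst d))"
    and "p \<in> fst c" "p \<in> fst d"
    and "(transition c d has_derivative F) (at (snd c p))"
    and "(local_rep d e f has_derivative G) (at (snd d p))"
  shows "(local_rep c e f has_derivative (\<lambda>w. G (F w))) (at (snd c p))"
proof (rule has_derivative_transform_within_open[OF _ assms(3)])
  show "((\<lambda>x. local_rep d e f (transition c d x)) has_derivative (\<lambda>w. G (F w))) (at (snd c p))"
    by (rule has_derivative_compose[OF assms(6)]) (simp add: local_rep_apply assms)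
qed (use assms(1,2,4,5) in \<open>auto simp: local_rep_apply\<close>)

text \<open>The self-transition is known to be the identity only on the image of the chart, as
  \<open>inv_into\<close> is arbitrary elsewhere; openness of that image settles the
  derivative.\<close>

lemma transition_self_has_derivative:
  assumes "inj_on (snd c) (fst c)" "open (snd c ` fst c)" "p \<in> fst c"
  shows "(transition c c has_derivative (\<lambda>w. w)) (at (snd c p))"
  by (rule has_derivative_transform_within_open[OF has_derivative_ident assms(2)])
    (use assms in \<open>auto simp: local_rep_apply\<close>)

section \<open>Transition maps and coordinate vectors of a fixed manifold\<close>

locale smooth_mfd =
  fixes X :: "'a topology" and A :: "('a, 'e::euclidean_space) chart set"
  assumes manifold: "smooth_manifold X A"
begin

abbreviation "TX \<equiv> tangent_topology X A"
abbreviation "TA \<equiv> tangent_atlas X A"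
abbreviation "tc \<equiv> tangent_chart X A"

lemma atlas_chart: "c \<in> A \<Longrightarrow> is_chart X c"
  using manifold by (simp add: smooth_manifold_def smooth_atlas_def)

lemmas atlas_inj = is_chart_inj[OF atlas_chart]

lemma atlas_cover: "p \<in> topspace X \<Longrightarrow> \<exists>c\<in>A. p \<in> fst c"
  using manifold unfolding smooth_manifold_def smooth_atlas_def by blast

lemma atlas_subset: "c \<in> A \<Longrightarrow> fst c \<subseteq> topspace X"
  using is_chart_openin[OF atlas_chart] openin_subset by blast

lemma transition_smooth:
  "c \<in> A \<Longrightarrow> d \<in> A \<Longrightarrow> smooth_on (transition c d) (snd c ` (fst c \<inter> fst d))"
  using manifold by (simp add: smooth_manifold_def smooth_atlas_def compatible_def)

lemma overlap_open: "c \<in> A \<Longrightarrow> d \<in> A \<Longrightarrow> open (snd c ` (fst c \<inter> fst d))"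
  by (simp add: is_chart_open_image[OF atlas_chart is_chart_openin[OF atlas_chart]])

lemma transition_has_derivative:
  assumes "c \<in> A" "d \<in> A" "p \<in> fst c" "p \<in> fst d"
  shows "(transition c d has_derivative frechet_derivative (transition c d) (at (snd c p))) (at (snd c p))"
  by (rule smooth_on_has_derivative[OF transition_smooth]) (use assms in auto)

text \<open>The chain rule for the identity map seen in three charts; it makes
  \<open>coord_vec\<close> obey the compatibility condition of \<open>tangent_space\<close>.\<close>

lemma transition_cocycle:
  assumes "c \<in> A" "d \<in> A" "e \<in> A" "p \<in> fst c" "p \<in> fst d" "p \<in> fst e"
  shows "frechet_derivative (transition c e) (at (snd c p)) v
    = frechet_derivative (transition d e) (at (snd d p)) (frechet_derivative (transition c d) (at (snd c p)) v)"
proof -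
  have "(transition c e has_derivative (\<lambda>v. frechet_derivative (transition d e) (at (snd d p))
      (frechet_derivative (transition c d) (at (snd c p)) v))) (at (snd c p))"
    by (rule local_rep_chain[OF atlas_inj[OF assms(1)] atlas_inj[OF assms(2)] overlap_open[OF assms(1,2)]
          assms(4,5) transition_has_derivative[OF assms(1,2,4,5)] transition_has_derivative[OF assms(2,3,5,6)]])
  from fun_cong[OF frechet_derivative_at[OF this]] show ?thesis by (rule sym)
qed

lemma coord_vec_self:
  assumes "c \<in> A" "p \<in> fst c"
  shows "coord_vec A c p v c = v"
proof -
  have "(transition c c has_derivative (\<lambda>w. w)) (at (snd c p))"
    using assms by (intro transition_self_has_derivative atlas_inj is_chart_open[OF atlas_chart])
  from fun_cong[OF frechet_derivative_at[OF this], symmetric] show ?thesis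
    using assms by (simp add: coord_vec_def)
qed

lemma coord_vec_tangent:
  assumes "c \<in> A" "p \<in> fst c"
  shows "coord_vec A c p v \<in> tangent_space A p"
  unfolding tangent_space_def
proof (intro CollectI conjI allI ballI impI)
  fix d e assume "d \<in> A" "e \<in> A" "p \<in> fst d \<and> p \<in> fst e"
  then show "coord_vec A c p v e = frechet_derivative (transition d e) (at (snd d p)) (coord_vec A c p v d)"
    using transition_cocycle[OF assms(1) _ _ assms(2), of d e v] by (simp add: coord_vec_def)
qed (auto simp: coord_vec_def)

section \<open>The charts of the tangent bundle\<close>

lemma tangent_chart_fst: "fst (tc d) = {z \<in> tangent_bundle X A. fst z \<in> fst d}"
  by (simp add: tangent_chart_def)

lemma tangent_chart_snd: "snd (tc d) z = (snd d (fst z), snd z d)"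
  by (simp add: tangent_chart_def)

lemma tangent_vector_transition:
  assumes "z \<in> tangent_bundle X A" "c \<in> A" "d \<in> A" "fst z \<in> fst c" "fst z \<in> fst d"
  shows "snd z d = frechet_derivative (transition c d) (at (snd c (fst z))) (snd z c)"
proof -
  have "snd z \<in> tangent_space A (fst z)"
    using assms(1) by (auto simp: tangent_bundle_def)
  then show ?thesis
    using assms unfolding tangent_space_def by blast
qed

text \<open>One entry determines those in all other charts around the base point through the
  transition derivatives, and the remaining entries are \<open>0\<close> by convention.\<close>

lemma tangent_vector_eqI:
  assumes "z \<in> tangent_bundle X A" "z' \<in> tangent_bundle X A" "c \<in> A" "fst z \<in> fst c"
    "fst z = fst z'" "snd z c = snd z' c"
  shows "z = z'"
proof (rule prod_eqI)
  show "snd z = snd z'"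
  proof
    fix d
    show "snd z d = snd z' d"
    proof (cases "d \<in> A \<and> fst z \<in> fst d")
      case True
      then have "d \<in> A" "fst z \<in> fst d" by auto
      then show ?thesis
        using tangent_vector_transition[OF assms(1,3) _ assms(4), of d]
          tangent_vector_transition[OF assms(2,3) _ assms(4)[unfolded assms(5)], of d] assms(5,6)
        by simp
    next
      case False
      have "snd y d = 0" if "y \<in> tangent_bundle X A" "fst y = fst z" for y
      proof -
        have "snd y \<in> tangent_space A (fst y)"
          using that(1) by (auto simp: tangent_bundle_def)
        then have "\<not> (d \<in> A \<and> fst y \<in> fst d) \<longrightarrow> snd y d = 0"
          unfolding tangent_space_def by (elim CollectE conjE allE)
        then show ?thesis using False that(2) by simp
      qed
      from this[OF assms(1)] this[OF assms(2) assms(5)[symmetric]] show ?thesis by simp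
    qed
  qed
qed (rule assms(5))

lemma tangent_chart_inj:
  assumes "d \<in> A"
  shows "inj_on (snd (tc d)) (fst (tc d))"
proof (rule inj_onI)
  fix z z' assume z: "z \<in> fst (tc d)" "z' \<in> fst (tc d)" "snd (tc d) z = snd (tc d) z'"
  then have "fst z = fst z'"
    using atlas_inj[OF assms] by (auto simp: tangent_chart_fst tangent_chart_snd inj_on_def)
  then show "z = z'"
    using z assms by (intro tangent_vector_eqI[of z z' d]) (auto simp: tangent_chart_fst tangent_chart_snd)
qed

lemma tangent_chart_inv:
  assumes "d \<in> A" "p \<in> fst d"
  shows "inv_into (fst (tc d)) (snd (tc d)) (snd d p, u) = (p, coord_vec A d p u)"
proof (rule inv_into_f_eq[OF tangent_chart_inj[OF assms(1)]])
  show "(p, coord_vec A d p u) \<in> fst (tc d)"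
    by (simp add: tangent_chart_fst tangent_bundle_def coord_vec_tangent assms
        subsetD[OF atlas_subset[OF assms(1)] assms(2)])
  show "snd (tc d) (p, coord_vec A d p u) = (snd d p, u)"
    using assms by (simp add: tangent_chart_snd coord_vec_self)
qed

lemma tangent_transition_apply:
  assumes "d \<in> A" "e \<in> A" "x \<in> snd d ` (fst d \<inter> fst e)"
  shows "transition (tc d) (tc e) (x, u) = (transition d e x, frechet_derivative (transition d e) (at x) u)"
proof -
  obtain p where p: "p \<in> fst d" "p \<in> fst e" "x = snd d p"
    using assms(3) by blast
  then show ?thesis
    using assms(1,2) tangent_chart_inv[OF assms(1) p(1)] inv_into_chart[OF atlas_inj[OF assms(1)] p(1)]
    by (simp add: local_rep_def tangent_chart_snd coord_vec_def)
qed

text \<open>The fibre part is linear in the vector, so it splits into coordinates of the vector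
  times directional derivatives of the base transition, which are smooth in the base point
  alone.\<close>

lemma tangent_transition_smooth:
  assumes "d \<in> A" "e \<in> A"
  shows "smooth_on (transition (tc d) (tc e)) (snd d ` (fst d \<inter> fst e) \<times> UNIV)"
proof -
  let ?S = "snd d ` (fst d \<inter> fst e)" and ?D = "\<lambda>x. frechet_derivative (transition d e) (at x)"
  note sm = transition_smooth[OF assms]
  have op: "open (?S \<times> (UNIV :: 'e set))" "open ?S"
    using overlap_open[OF assms] open_Times by auto
  have sub: "fst ` (?S \<times> (UNIV :: 'e set)) \<subseteq> ?S" by auto
  have "Ck_on k (\<lambda>y. (transition d e (fst y), \<Sum>b\<in>Basis. (snd y \<bullet> b) *\<^sub>R ?D (fst y) b)) (?S \<times> UNIV)" for k
  proof (intro Ck_on_Pair Ck_on_sum Ck_on_scaleR op)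
    have id: "Ck_on k (\<lambda>y. y) (?S \<times> (UNIV :: 'e set))"
      using smooth_on_ident[OF op(1)] by (simp add: smooth_on_def)
    have fst: "Ck_on k fst (?S \<times> (UNIV :: 'e set))"
      using Ck_on_linear[OF op(1) bounded_linear_fst id] .
    show "Ck_on k (\<lambda>y. transition d e (fst y)) (?S \<times> (UNIV :: 'e set))"
      by (rule Ck_on_compose[OF op sub fst sm[unfolded smooth_on_def, rule_format]])
    fix b :: 'e
    show "Ck_on k (\<lambda>y. ?D (fst y) b) (?S \<times> (UNIV :: 'e set))"
      by (rule Ck_on_compose[OF op sub fst smooth_on_derivative[OF sm, unfolded smooth_on_def, rule_format]])
    show "Ck_on k (\<lambda>y. snd y \<bullet> b) (?S \<times> (UNIV :: 'e set))"
      using Ck_on_linear[OF op(1) bounded_linear_compose[OF bounded_linear_inner_left bounded_linear_snd] id] .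
  qed
  then have "smooth_on (\<lambda>y. (transition d e (fst y), \<Sum>b\<in>Basis. (snd y \<bullet> b) *\<^sub>R ?D (fst y) b)) (?S \<times> UNIV)"
    by (simp add: smooth_on_def)
  then show ?thesis
  proof (rule smooth_on_cong_open[OF op(1), rotated])
    fix y :: "'e \<times> 'e" assume y: "y \<in> ?S \<times> UNIV"
    then have "linear (?D (fst y))"
      using has_derivative_linear[OF smooth_on_has_derivative[OF sm]] by auto
    from linear_basis_expansion[OF this, of "snd y"] y
    show "(transition d e (fst y), \<Sum>b\<in>Basis. (snd y \<bullet> b) *\<^sub>R ?D (fst y) b) = transition (tc d) (tc e) y"
      using tangent_transition_apply[OF assms, of "fst y" "snd y"] by auto
  qed
qed

lemma tangent_transition_has_derivative:
  assumes "d \<in> A" "e \<in> A" "z \<in> fst (tc d)" "z \<in> fst (tc e)"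
  shows "(transition (tc d) (tc e) has_derivative
    frechet_derivative (transition (tc d) (tc e)) (at (snd (tc d) z))) (at (snd (tc d) z))"
proof (rule smooth_on_has_derivative[OF tangent_transition_smooth[OF assms(1,2)]])
  have "fst z \<in> fst d \<inter> fst e"
    using assms(3,4) by (simp add: tangent_chart_fst)
  then show "snd (tc d) z \<in> snd d ` (fst d \<inter> fst e) \<times> UNIV"
    by (simp add: tangent_chart_snd)
qed

text \<open>Seen from a tangent chart over \<open>d\<close>, the projection is the first coordinate
  followed by the transition to \<open>e\<close>, so its derivative factors through the base
  part.\<close>

lemma projection_has_derivative:
  assumes "d \<in> A" "e \<in> A" "z \<in> fst (tc d)" "fst z \<in> fst e"
  shows "(local_rep (tc d) e fst has_derivative
    (\<lambda>y. frechet_derivative (transition d e) (at (snd d (fst z))) (fst y))) (at (snd (tc d) z))"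
proof (rule has_derivative_transform_within_open)
  have d: "fst z \<in> fst d" using assms(3) by (simp add: tangent_chart_fst)
  show "((\<lambda>y. transition d e (fst y)) has_derivative
    (\<lambda>y. frechet_derivative (transition d e) (at (snd d (fst z))) (fst y))) (at (snd (tc d) z))"
    using has_derivative_compose[OF has_derivative_fst[OF has_derivative_ident], of "transition d e" _ "snd (tc d) z" UNIV]
      transition_has_derivative[OF assms(1,2) d assms(4)] by (simp add: tangent_chart_snd)
  show "open (snd d ` (fst d \<inter> fst e) \<times> (UNIV :: 'e set))"
    using overlap_open[OF assms(1,2)] by (simp add: open_Times)
  show "snd (tc d) z \<in> snd d ` (fst d \<inter> fst e) \<times> UNIV"
    using d assms(4) by (simp add: tangent_chart_snd)
  fix y assume "y \<in> snd d ` (fst d \<inter> fst e) \<times> (UNIV :: 'e set)"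
  then show "transition d e (fst y) = local_rep (tc d) e fst y"
    using assms(1) by (auto simp: local_rep_def tangent_chart_inv atlas_inj)
qed

section \<open>The topology of the tangent bundle\<close>

lemma tangent_open:
  assumes "d \<in> A" "open W"
  shows "openin TX {z \<in> fst (tc d). snd (tc d) z \<in> W}"
  unfolding tangent_topology_def
proof (rule topology_generated_by_Basis, rule CollectI, rule exI[of _ "tc d"], rule exI[of _ W], intro conjI)
  show "tc d \<in> TA"
    unfolding tangent_atlas_def using assms(1) by (rule imageI)
qed (rule refl, rule assms(2))

lemma tangent_chart_openin: "d \<in> A \<Longrightarrow> openin TX (fst (tc d))"
  using tangent_open[of d UNIV] by simp

lemma tangent_bundle_cover: "z \<in> tangent_bundle X A \<Longrightarrow> \<exists>d\<in>A. z \<in> fst (tc d)"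
  using atlas_cover by (auto simp: tangent_bundle_def tangent_chart_fst)

lemma topspace_tangent: "topspace TX = tangent_bundle X A"
proof
  show "tangent_bundle X A \<subseteq> topspace TX"
  proof
    fix z assume "z \<in> tangent_bundle X A"
    then obtain d where "d \<in> A" "z \<in> fst (tc d)"
      using tangent_bundle_cover by blast
    then show "z \<in> topspace TX"
      using openin_subset[OF tangent_chart_openin] by blast
  qed
  show "topspace TX \<subseteq> tangent_bundle X A"
  proof
    fix z assume "z \<in> topspace TX"
    then obtain Z where Z: "z \<in> Z" "Z \<in> {{z \<in> fst C. snd C z \<in> W} | C W. C \<in> TA \<and> open W}"
      unfolding tangent_topology_def topology_generated_by_topspace by (rule UnionE)
    from Z(2) obtain C W where "Z = {z \<in> fst C. snd C z \<in> W}" "C \<in> TA"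
      by (elim CollectE exE conjE)
    then have C: "C \<in> TA" "z \<in> fst C" using Z(1) by simp_all
    from C(1) obtain d where "C = tc d"
      unfolding tangent_atlas_def by (rule imageE)
    then show "z \<in> tangent_bundle X A"
      using C(2) by (simp add: tangent_chart_fst)
  qed
qed

lemma projection_continuous: "continuous_map TX X fst"
  unfolding continuous_map_def
proof (intro conjI allI impI)
  show "fst \<in> topspace TX \<rightarrow> topspace X"
    by (auto simp: topspace_tangent tangent_bundle_def)
  fix W assume W: "openin X W"
  show "openin TX {z \<in> topspace TX. fst z \<in> W}"
  proof (subst openin_subopen, clarify)
    fix p v assume z: "(p, v) \<in> topspace TX" "fst (p, v) \<in> W"
    then obtain d where d: "d \<in> A" "(p, v) \<in> fst (tc d)"
      using tangent_bundle_cover topspace_tangent by blast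
    let ?V = "{z \<in> fst (tc d). snd (tc d) z \<in> snd d ` (fst d \<inter> W) \<times> UNIV}"
    have "openin TX ?V"
      using d is_chart_open_image[OF atlas_chart W] by (intro tangent_open open_Times) auto
    moreover have "(p, v) \<in> ?V"
      using d z by (auto simp: tangent_chart_fst tangent_chart_snd)
    moreover have "?V \<subseteq> {z \<in> topspace TX. fst z \<in> W}"
      using atlas_inj[OF d(1)] by (auto simp: tangent_chart_fst tangent_chart_snd topspace_tangent inj_on_def)
    ultimately show "\<exists>T. openin TX T \<and> (p, v) \<in> T \<and> T \<subseteq> {z \<in> topspace TX. fst z \<in> W}"
      by (intro exI[of _ ?V] conjI)
  qed
qed

text \<open>Different base points are separated by pulling back neighbourhoods from
  \<open>X\<close>; vectors at one base point lie in a common tangent chart and are separated there.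
  Uniqueness of lifts to \<open>N\<close> rests on this.\<close>

lemma Hausdorff_tangent: "Hausdorff_space TX"
  unfolding Hausdorff_space_def
proof (intro allI impI, elim conjE)
  fix z z' assume z: "z \<in> topspace TX" "z' \<in> topspace TX" "z \<noteq> z'"
  show "\<exists>U V. openin TX U \<and> openin TX V \<and> z \<in> U \<and> z' \<in> V \<and> disjnt U V"
  proof (cases "fst z = fst z'")
    case False
    have "Hausdorff_space X" using manifold by (simp add: smooth_manifold_def)
    moreover have "fst z \<in> topspace X" "fst z' \<in> topspace X"
      using z by (auto simp: topspace_tangent tangent_bundle_def)
    ultimately obtain U V where UV: "openin X U" "openin X V" "fst z \<in> U" "fst z' \<in> V" "disjnt U V"
      using False unfolding Hausdorff_space_def by metis
    show ?thesis
      by (rule exI[of _ "{z \<in> topspace TX. fst z \<in> U}"], rule exI[of _ "{z \<in> topspace TX. fst z \<in> V}"])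
        (intro conjI openin_continuous_map_preimage[OF projection_continuous],
          use UV z in \<open>auto simp: disjnt_iff\<close>)
  next
    case True
    obtain d where d: "d \<in> A" "z \<in> fst (tc d)"
      using tangent_bundle_cover z topspace_tangent by blast
    then have d': "z' \<in> fst (tc d)"
      using True z by (auto simp: tangent_chart_fst topspace_tangent)
    then have "snd (tc d) z \<noteq> snd (tc d) z'"
      using tangent_chart_inj[OF d(1)] d z by (auto simp: inj_on_def)
    then obtain U V where UV: "open U" "open V" "snd (tc d) z \<in> U" "snd (tc d) z' \<in> V" "U \<inter> V = {}"
      by (elim hausdorff[THEN exE] exE conjE)
    let ?P = "\<lambda>W. {z \<in> fst (tc d). snd (tc d) z \<in> W}"
    have "disjnt (?P U) (?P V)"
      using UV(5) unfolding disjnt_def by blast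
    then show ?thesis
      using d(2) d' UV(3,4) tangent_open[OF d(1) UV(1)] tangent_open[OF d(1) UV(2)]
      by (metis (no_types, lifting) mem_Collect_eq)
  qed
qed

end


section \<open>Slice charts of transverse submanifolds\<close>

lemma local_rep_id_chart:
  "t \<in> I \<Longrightarrow> local_rep (I, id) d f t = snd d (f t)"
  by (simp add: local_rep_def inv_into_f_f[of id I t, simplified])

lemma open_line_interval:
  fixes a w :: "'e::real_normed_vector"
  assumes "open S" "a \<in> S"
  obtains \<epsilon> where "\<epsilon> > 0" "\<And>t. t \<in> {-\<epsilon><..<\<epsilon>} \<Longrightarrow> a + t *\<^sub>R w \<in> S"
proof -
  have "open ((\<lambda>t. a + t *\<^sub>R w) -` S)"
    by (intro open_vimage assms continuous_intros)
  then obtain \<epsilon> where "\<epsilon> > 0" "ball 0 \<epsilon> \<subseteq> (\<lambda>t. a + t *\<^sub>R w) -` S"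
    by (rule openE[where x = 0]) (use assms(2) in simp)
  then show ?thesis
    by (intro that[of \<epsilon>]) (auto simp: subset_eq dist_real_def abs_less_iff minus_less_iff)
qed

context smooth_mfd
begin

lemma tangent_chart_in_atlas: "d \<in> A \<Longrightarrow> tc d \<in> TA"
  by (simp add: tangent_atlas_def)

lemma tangent_atlasE: "T \<in> TA \<Longrightarrow> (\<And>d. d \<in> A \<Longrightarrow> T = tc d \<Longrightarrow> P) \<Longrightarrow> P"
  by (auto simp: tangent_atlas_def)

section \<open>Slice charts compared with tangent charts\<close>

context
  fixes c :: "('a \<times> ('a, 'e) tvec, 'e \<times> 'e) chart"
  assumes maximal: "c \<in> maximal_atlas TX TA"
begin

lemma slice_chart: "is_chart TX c"
  using maximal by (simp add: maximal_atlas_def)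

lemmas slice_inj = is_chart_inj[OF slice_chart]

lemma slice_overlap_open: "T \<in> TA \<Longrightarrow> open (snd c ` (fst c \<inter> fst T))"
  by (elim tangent_atlasE) (simp add: is_chart_open_image[OF slice_chart] tangent_chart_openin)

lemma slice_transition_smooth: "T \<in> TA \<Longrightarrow> smooth_on (transition c T) (snd c ` (fst c \<inter> fst T))"
  using maximal by (simp add: maximal_atlas_def compatible_def)

lemma slice_transition_has_derivative:
  assumes "T \<in> TA" "z \<in> fst c" "z \<in> fst T"
  shows "(transition c T has_derivative frechet_derivative (transition c T) (at (snd c z))) (at (snd c z))"
  by (rule smooth_on_has_derivative[OF slice_transition_smooth[OF assms(1)]]) (use assms in blast)

text \<open>The reverse transition is differentiable too, and by the chain rule the two derivatives
  compose to that of the identity.\<close>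

lemma slice_transition_injective:
  assumes T: "T \<in> TA" "z \<in> fst c" "z \<in> fst T"
    and zero: "frechet_derivative (transition c T) (at (snd c z)) w = 0"
  shows "w = 0"
proof -
  obtain d where d: "d \<in> A" "T = tc d" using T(1) by (rule tangent_atlasE)
  have "smooth_on (transition T c) (snd T ` (fst c \<inter> fst T))"
    using maximal T(1) by (simp add: maximal_atlas_def compatible_def)
  then have "(transition T c has_derivative frechet_derivative (transition T c) (at (snd T z))) (at (snd T z))"
    by (rule smooth_on_has_derivative) (use T in blast)
  from local_rep_chain[OF slice_inj tangent_chart_inj[OF d(1), folded d(2)] slice_overlap_open[OF T(1)] T(2,3)
      slice_transition_has_derivative[OF T] this]
  have "(transition c c has_derivative (\<lambda>w. frechet_derivative (transition T c) (at (snd T z))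
      (frechet_derivative (transition c T) (at (snd c z)) w))) (at (snd c z))" .
  from has_derivative_unique[OF transition_self_has_derivative[OF slice_inj is_chart_open[OF slice_chart] T(2)] this]
  have "w = frechet_derivative (transition T c) (at (snd T z)) 0"
    using zero by metis
  then show ?thesis
    using linear_0[OF has_derivative_linear[OF \<open>(transition T c has_derivative _) _\<close>]] by simp
qed

text \<open>A line through \<open>snd c z\<close> in direction \<open>w\<close> stays in
  \<open>L\<close>, so near \<open>z\<close> it describes a curve in \<open>N\<close> with velocity
  \<open>w\<close> in the chart \<open>c\<close>. A zero base part makes this velocity vertical,
  transversality makes it vanish, and the injective transition derivative carries this back to
  \<open>w\<close>.\<close>

lemma transverse_slice:
  assumes N: "snd c ` (N \<inter> fst c) = snd c ` fst c \<inter> L" "subspace L"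
    and z: "z \<in> N" "z \<in> fst c" and w: "w \<in> L"
    and d: "d \<in> A" "fst z \<in> fst d"
    and transverse: "transverse_to_fiber X A N z"
    and zero: "fst (frechet_derivative (transition c (tc d)) (at (snd c z)) w) = 0"
  shows "w = 0"
proof -
  let ?D = "\<lambda>T. frechet_derivative (transition c T) (at (snd c z))"
  define \<gamma> where "\<gamma> = (\<lambda>t. inv_into (fst c) (snd c) (snd c z + t *\<^sub>R w))"
  \<comment> \<open>The velocity of \<open>\<gamma>\<close>, written through transition derivatives
    so that membership in \<open>tangent_space\<close> is just the chain rule;
    \<open>velocity\<close> identifies it with the actual velocity.\<close>
  define v where "v = (\<lambda>T. if T \<in> TA \<and> z \<in> fst T then ?D T w else 0)"
  have zTX: "z \<in> tangent_bundle X A"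
    using z(2) openin_subset[OF is_chart_openin[OF slice_chart]] topspace_tangent by blast
  have zT: "z \<in> fst (tc d)"
    using zTX d(2) by (simp add: tangent_chart_fst)
  obtain \<epsilon> where \<epsilon>: "\<epsilon> > 0" "\<And>t. t \<in> {-\<epsilon><..<\<epsilon>} \<Longrightarrow> snd c z + t *\<^sub>R w \<in> snd c ` fst c"
    using open_line_interval[OF is_chart_open[OF slice_chart]] z(2) by (metis imageI)
  let ?I = "{-\<epsilon><..<\<epsilon>}"
  have \<gamma>: "\<gamma> t \<in> fst c" "snd c (\<gamma> t) = snd c z + t *\<^sub>R w" if "t \<in> ?I" for t
    using \<epsilon>(2)[OF that] unfolding \<gamma>_def by (simp_all add: inv_into_into f_inv_into_f)
  have \<gamma>0: "\<gamma> 0 = z"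
    using inv_into_chart[OF slice_inj z(2)] by (simp add: \<gamma>_def)
  have "snd c z \<in> L" using N(1) z by blast
  have \<gamma>N: "\<gamma> t \<in> N" if "t \<in> ?I" for t
  proof -
    have "snd c z + t *\<^sub>R w \<in> L"
      using \<open>snd c z \<in> L\<close> w N(2) by (simp add: subspace_add subspace_scale)
    then have "snd c (\<gamma> t) \<in> snd c ` (N \<inter> fst c)"
      using N(1) \<gamma>[OF that] \<epsilon>(2)[OF that] by auto
    then show ?thesis
      using \<gamma>(1)[OF that] slice_inj by (auto simp: inj_on_def)
  qed
  have cont: "continuous_map (top_of_set ?I) TX \<gamma>"
  proof -
    have "continuous_map (top_of_set ?I) (top_of_set (snd c ` fst c)) (\<lambda>t. snd c z + t *\<^sub>R w)"
      using \<epsilon>(2) by (auto intro!: continuous_intros)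
    from continuous_map_compose[OF this is_chart_continuous_inv[OF slice_chart]]
    show ?thesis by (simp add: \<gamma>_def o_def)
  qed
  have rep: "snd T (\<gamma> t) = transition c T (snd c z + t *\<^sub>R w)" if "t \<in> ?I" for T and t :: real
    by (simp add: local_rep_def \<gamma>_def)
  have smooth: "smooth_map (top_of_set ?I) {(?I, id)} TX TA \<gamma>"
    unfolding smooth_map_def
  proof (intro conjI cont ballI)
    fix c' T assume c': "c' \<in> {(?I, id :: real \<Rightarrow> real)}" and T: "T \<in> TA"
    let ?J = "{t \<in> ?I. \<gamma> t \<in> fst T}"
    have "openin TX (fst T)"
      using T by (elim tangent_atlasE) (simp add: tangent_chart_openin)
    from openin_continuous_map_preimage[OF cont this]
    have "openin (top_of_set ?I) ?J"
      by simp
    then have J: "open ?J"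
      using openin_open_trans[of ?I ?J] by simp
    have "smooth_on (\<lambda>t. transition c T (snd c z + t *\<^sub>R w)) ?J"
    proof (rule smooth_on_compose[where f = "\<lambda>t. snd c z + t *\<^sub>R w", OF J slice_overlap_open[OF T] _ _
            slice_transition_smooth[OF T]])
      show "(\<lambda>t. snd c z + t *\<^sub>R w) ` ?J \<subseteq> snd c ` (fst c \<inter> fst T)"
      proof (rule image_subsetI)
        fix t assume "t \<in> ?J"
        then have t: "t \<in> ?I" "\<gamma> t \<in> fst T" by simp_all
        show "snd c z + t *\<^sub>R w \<in> snd c ` (fst c \<inter> fst T)"
          using \<gamma>[OF t(1)] t(2) by (intro image_eqI[of _ _ "\<gamma> t"]) simp_all
      qed
      show "smooth_on (\<lambda>t. snd c z + t *\<^sub>R w) ?J"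
        by (rule smooth_on_affine[OF J bounded_linear_scaleR_left])
    qed
    then have "smooth_on (local_rep (?I, id) T \<gamma>) ?J"
      by (rule smooth_on_cong_open[OF J, rotated]) (simp add: local_rep_id_chart rep)
    then show "smooth_on (local_rep c' T \<gamma>) (snd c' ` {t \<in> fst c'. \<gamma> t \<in> fst T})"
      using c' by simp
  qed
  have velocity: "vector_derivative (snd T \<circ> \<gamma>) (at 0) = ?D T w" if T: "T \<in> TA" "z \<in> fst T" for T
  proof -
    have "((\<lambda>t. snd c z + t *\<^sub>R w) has_derivative (\<lambda>t. t *\<^sub>R w)) (at 0)"
      by (auto intro!: derivative_eq_intros)
    moreover have "(transition c T has_derivative ?D T) (at (snd c z + 0 *\<^sub>R w))"
      using slice_transition_has_derivative[OF T(1) z(2) T(2)] by simp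
    ultimately have "((\<lambda>t. transition c T (snd c z + t *\<^sub>R w)) has_derivative (\<lambda>t. ?D T (t *\<^sub>R w))) (at 0)"
      by (rule has_derivative_compose)
    then have "((snd T \<circ> \<gamma>) has_derivative (\<lambda>t. ?D T (t *\<^sub>R w))) (at 0)"
      by (rule has_derivative_transform_within_open[of _ _ _ _ ?I]) (use \<epsilon>(1) in \<open>auto simp: rep[of _ T]\<close>)
    moreover have "?D T (t *\<^sub>R w) = t *\<^sub>R ?D T w" for t
      by (rule linear_scale[OF has_derivative_linear[OF slice_transition_has_derivative[OF T(1) z(2) T(2)]]])
    ultimately have "((snd T \<circ> \<gamma>) has_vector_derivative ?D T w) (at 0)"
      by (simp add: has_vector_derivative_def)
    then show ?thesis by (rule vector_derivative_at)
  qed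
  have "v \<in> submanifold_tangent_space TX TA N z"
    unfolding submanifold_tangent_space_def
  proof (intro CollectI exI[of _ \<gamma>] exI[of _ \<epsilon>] conjI \<epsilon>(1) \<gamma>0 smooth)
    show "\<gamma> ` ?I \<subseteq> N" using \<gamma>N by blast
    show "v = (\<lambda>T. if T \<in> TA \<and> z \<in> fst T then vector_derivative (snd T \<circ> \<gamma>) (at 0) else 0)"
      unfolding v_def using velocity by (intro ext) simp
  qed
  moreover have "v \<in> tangent_space TA z"
    unfolding tangent_space_def
  proof (intro CollectI conjI allI ballI impI)
    fix T T' assume T: "T \<in> TA" "T' \<in> TA" "z \<in> fst T \<and> z \<in> fst T'"
    obtain e e' where e: "e \<in> A" "T = tc e" "e' \<in> A" "T' = tc e'"
      using T(1,2) by (meson tangent_atlasE)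
    have "(transition T T' has_derivative frechet_derivative (transition T T') (at (snd T z))) (at (snd T z))"
      unfolding e(2,4) by (rule tangent_transition_has_derivative) (use e T in auto)
    from local_rep_chain[OF slice_inj tangent_chart_inj[OF e(1), folded e(2)] slice_overlap_open[OF T(1)] z(2) _
        slice_transition_has_derivative[OF T(1) z(2)] this] T(3)
    have "(transition c T' has_derivative (\<lambda>w. frechet_derivative (transition T T') (at (snd T z)) (?D T w))) (at (snd c z))"
      by blast
    from fun_cong[OF frechet_derivative_at[OF this], of w]
    show "v T' = frechet_derivative (transition T T') (at (snd T z)) (v T)"
      using T by (simp add: v_def)
  qed (auto simp: v_def)
  moreover have "differential TA A fst z v = (\<lambda>_. 0)"
  proof -
    \<comment> \<open>\<open>differential\<close> reads \<open>v\<close> in a chart picked by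
      choice, while \<open>zero\<close> concerns the chart over \<open>d\<close>. The derivative of
      the projection in the chart \<open>c\<close> can be computed through either one, and its
      uniqueness transfers the vanishing.\<close>
    define T0 where "T0 = (SOME T. T \<in> TA \<and> z \<in> fst T)"
    have T0: "T0 \<in> TA" "z \<in> fst T0"
      using someI[of "\<lambda>T. T \<in> TA \<and> z \<in> fst T", OF conjI[OF tangent_chart_in_atlas[OF d(1)] zT]]
      unfolding T0_def by blast+
    have chain: "(local_rep c e fst has_derivative (\<lambda>y. frechet_derivative (local_rep T e fst) (at (snd T z)) (?D T y))) (at (snd c z))"
        "frechet_derivative (local_rep (tc a) e fst) (at (snd (tc a) z))
          = (\<lambda>y. frechet_derivative (transition a e) (at (snd a (fst z))) (fst y))"
      if "a \<in> A" "T = tc a" "z \<in> fst T" "e \<in> A" "fst z \<in> fst e" for a T e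
    proof -
      have T: "T \<in> TA" using tangent_chart_in_atlas[OF that(1)] that(2) by simp
      note der = projection_has_derivative[OF that(1,4) that(3)[unfolded that(2)] that(5)]
      show *: "frechet_derivative (local_rep (tc a) e fst) (at (snd (tc a) z))
          = (\<lambda>y. frechet_derivative (transition a e) (at (snd a (fst z))) (fst y))"
        by (rule frechet_derivative_at[OF der, symmetric])
      show "(local_rep c e fst has_derivative (\<lambda>y. frechet_derivative (local_rep T e fst) (at (snd T z)) (?D T y))) (at (snd c z))"
        by (rule local_rep_chain[OF slice_inj tangent_chart_inj[OF that(1), folded that(2)] slice_overlap_open[OF T]
              z(2) that(3) slice_transition_has_derivative[OF T z(2) that(3)]])
          (use der * that(2) in simp)
    qed
    have "frechet_derivative (local_rep T0 e fst) (at (snd T0 z)) (v T0) = 0" if e: "e \<in> A" "fst z \<in> fst e" for e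
    proof -
      obtain a where a: "a \<in> A" "T0 = tc a" using T0(1) by (rule tangent_atlasE)
      have "frechet_derivative (local_rep T0 e fst) (at (snd T0 z)) (?D T0 w)
          = frechet_derivative (local_rep (tc d) e fst) (at (snd (tc d) z)) (?D (tc d) w)"
        using fun_cong[OF has_derivative_unique[OF chain(1)[OF a T0(2) e] chain(1)[OF d(1) refl zT e]], of w] .
      also have "\<dots> = frechet_derivative (transition d e) (at (snd d (fst z))) 0"
        using zero by (simp add: chain(2)[OF d(1) refl zT e])
      also have "\<dots> = 0"
        by (rule linear_0[OF has_derivative_linear[OF transition_has_derivative[OF d(1) e(1) d(2) e(2)]]])
      finally show ?thesis using T0 by (simp add: v_def)
    qed
    then show ?thesis
      unfolding differential_def T0_def[symmetric] Let_def by (intro ext) simp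
  qed
  ultimately have "v = (\<lambda>_. 0)"
    using transverse unfolding transverse_to_fiber_def by blast
  then have "?D (tc d) w = 0"
    using tangent_chart_in_atlas[OF d(1)] zT by (metis v_def)
  then show ?thesis
    using slice_transition_injective[OF tangent_chart_in_atlas[OF d(1)] z(2) zT] by blast
qed

end

end

text \<open>In a slice chart \<open>c\<close> the submanifold is parametrized by a linear isomorphism onto \<open>L\<close>; the
  base coordinates of this parametrization form a map between open subsets of the same Euclidean
  space whose derivative is injective by transversality.\<close>

lemma transverse_local_section:
  fixes A :: "('a, real ^ 'n) chart set"
  assumes "smooth_manifold X A"
    and sub: "submanifold (tangent_topology X A) (tangent_atlas X A) CARD('n) N"
    and transverse: "\<forall>z\<in>N. transverse_to_fiber X A N z"
    and z: "z \<in> N"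
  obtains V s where "openin (subtopology (tangent_topology X A) N) V" "z \<in> V"
    "path_connectedin (subtopology (tangent_topology X A) N) V"
    "openin X (fst ` V)"
    "continuous_map (subtopology X (fst ` V)) (subtopology (tangent_topology X A) N) s"
    "\<And>v. v \<in> V \<Longrightarrow> s (fst v) = v"
    "\<And>e T. e \<in> A \<Longrightarrow> T \<in> tangent_atlas X A \<Longrightarrow>
      smooth_on (local_rep e T s) (snd e ` {p \<in> fst e. p \<in> fst ` V \<and> s p \<in> fst T})"
proof -
  interpret smooth_mfd X A by unfold_locales (rule assms)
  let ?Y = "subtopology TX N"
  obtain c L where c: "c \<in> maximal_atlas TX TA" and zc: "z \<in> fst c" and L: "subspace L" "dim L = CARD('n)"
    and slice: "snd c ` (N \<inter> fst c) = snd c ` fst c \<inter> L"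
    using sub z unfolding submanifold_def by blast
  note chart = slice_chart[OF c] and inj = slice_inj[OF c]
  have NTX: "N \<subseteq> topspace TX" using sub by (simp add: submanifold_def)
  then obtain d where d: "d \<in> A" "z \<in> fst (tc d)"
    using z tangent_bundle_cover topspace_tangent by blast
  note T = tangent_chart_in_atlas[OF d(1)]
  let ?T = "tc d"
  have dim: "dim (UNIV :: (real ^ 'n) set) = dim L" by (simp add: L(2))
  \<comment> \<open>Linear coordinates on \<open>L\<close>, a subspace of the space of pairs; the
    left inverse \<open>g\<close> is defined on the whole of that space.\<close>
  obtain l g where lg: "linear l" "linear g" "l ` (UNIV :: (real ^ 'n) set) = L"
      "\<And>y. g (l y) = y" "\<And>x. x \<in> L \<Longrightarrow> l (g x) = x"
    by (rule isometries_subspaces[OF subspace_UNIV L(1) dim], rule that) (assumption | simp)+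
  have bl: "bounded_linear l" "bounded_linear g"
    using lg(1,2) by (simp_all add: linear_linear)
  define a where "a = snd c z"
  have aL: "a \<in> L" using slice z zc unfolding a_def by blast
  \<comment> \<open>The parametrization of \<open>N\<close> near \<open>z\<close>: slice coordinates
    \<open>a + l y\<close>. The set \<open>W\<close> keeps the point inside both charts.\<close>
  define \<sigma> where "\<sigma> = (\<lambda>y. inv_into (fst c) (snd c) (a + l y))"
  define W where "W = {y. a + l y \<in> snd c ` (fst c \<inter> fst ?T)}"
  have cont_al: "continuous_on S (\<lambda>y. a + l y)" for S
    by (intro continuous_intros linear_continuous_on bl)
  have W: "open W"
  proof -
    have "open ((\<lambda>y. a + l y) -` (snd c ` (fst c \<inter> fst ?T)))"
      by (rule open_vimage[OF slice_overlap_open[OF c T] cont_al])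
    then show ?thesis by (simp add: W_def vimage_def)
  qed
  have \<sigma>: "\<sigma> y \<in> fst c" "\<sigma> y \<in> fst ?T" "snd c (\<sigma> y) = a + l y" "\<sigma> y \<in> N" if "y \<in> W" for y
  proof -
    from that obtain p where p: "p \<in> fst c" "p \<in> fst ?T" "a + l y = snd c p"
      unfolding W_def by blast
    then have "\<sigma> y = p" using inv_into_chart[OF inj p(1)] by (simp add: \<sigma>_def)
    then show "\<sigma> y \<in> fst c" "\<sigma> y \<in> fst ?T" and eq: "snd c (\<sigma> y) = a + l y" using p by simp_all
    have "a + l y \<in> L" using aL lg(3) L(1) by (auto intro: subspace_add)
    then have "snd c p \<in> snd c ` (N \<inter> fst c)" using slice p by auto
    then show "\<sigma> y \<in> N" using \<open>\<sigma> y = p\<close> inj p(1) by (auto simp: inj_on_def)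
  qed
  have l0: "l 0 = 0" by (rule linear_0[OF lg(1)])
  have W0: "0 \<in> W" unfolding W_def a_def using l0 zc d(2) by simp
  have \<sigma>0: "\<sigma> 0 = z" using inv_into_chart[OF inj zc] l0 by (simp add: \<sigma>_def a_def)
  have \<sigma>_param: "g (snd c p - a) = y \<longleftrightarrow> p = \<sigma> y" if "p \<in> N" "p \<in> fst c" "y \<in> W" for p y
  proof
    assume "p = \<sigma> y"
    then show "g (snd c p - a) = y" using \<sigma>(3)[OF that(3)] lg(4) by simp
  next
    assume y: "g (snd c p - a) = y"
    have "snd c p \<in> L" using slice that by blast
    then have "l y = snd c p - a" using y lg(5) aL L(1) by (metis subspace_diff)
    then show "p = \<sigma> y" using inv_into_chart[OF inj that(2)] by (simp add: \<sigma>_def)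
  qed
  define h where "h = (\<lambda>y. fst (transition c ?T (a + l y)))"
  have h: "h y = snd d (fst (\<sigma> y))" for y
    by (simp add: h_def local_rep_def \<sigma>_def tangent_chart_snd)
  have al_W: "(\<lambda>y. a + l y) ` W \<subseteq> snd c ` (fst c \<inter> fst ?T)" by (auto simp: W_def)
  have smooth_h: "smooth_on h W"
    unfolding h_def
    by (intro smooth_on_linear[OF W bounded_linear_fst]
        smooth_on_compose[where f = "\<lambda>y. a + l y", OF W slice_overlap_open[OF c T] al_W _ slice_transition_smooth[OF c T]]
        smooth_on_affine[OF W bl(1)])
  have injective: "w = 0" if "frechet_derivative h (at 0) w = 0" for w
  proof -
    let ?D = "frechet_derivative (transition c ?T) (at (snd c z))"
    have "((\<lambda>y. a + l y) has_derivative l) (at 0)"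
      using bounded_linear.has_derivative[OF bl(1) has_derivative_ident] by (auto intro!: derivative_eq_intros)
    moreover have "(transition c ?T has_derivative ?D) (at (a + l 0))"
      using slice_transition_has_derivative[OF c T zc d(2)] l0 by (simp add: a_def)
    ultimately have "((\<lambda>y. transition c ?T (a + l y)) has_derivative (\<lambda>w. ?D (l w))) (at 0)"
      by (rule has_derivative_compose)
    from has_derivative_fst[OF this] have "(h has_derivative (\<lambda>w. fst (?D (l w)))) (at 0)"
      by (simp add: h_def)
    then have "fst (?D (l w)) = 0"
      using that frechet_derivative_at by metis
    moreover have "fst z \<in> fst d" using d(2) by (simp add: tangent_chart_fst)
    ultimately have "l w = 0"
      using transverse_slice[OF c slice L(1) z zc _ d(1)] transverse z lg(3) by blast
    then show ?thesis using lg(4)[of w] linear_0[OF lg(2)] by simp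
  qed
  obtain U' H k where U': "open U'" "U' \<subseteq> W" "0 \<in> U'" "open H" "homeomorphism U' H h k" "smooth_on k H"
    using smooth_inverse_function[OF W W0 smooth_h injective] by metis
  \<comment> \<open>Shrinking to a ball makes the resulting piece of \<open>N\<close> path
    connected.\<close>
  obtain r where r: "r > 0" "ball 0 r \<subseteq> U'"
    using U'(1,3) open_contains_ball by blast
  let ?B = "ball (0 :: real ^ 'n) r"
  have kh: "k (h y) = y" if "y \<in> ?B" for y
    using U'(5) r that by (auto simp: homeomorphism_def)
  define Q where "Q = h ` ?B"
  have Q: "open Q" "Q \<subseteq> H"
  proof -
    have "Q = H \<inter> k -` ?B"
      using U'(5) r(2) unfolding Q_def homeomorphism_def by force
    then show "open Q" "Q \<subseteq> H"
      using continuous_open_preimage[OF smooth_on_continuous[OF U'(6)] U'(4) open_ball] by simp_all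
  qed
  have BW: "?B \<subseteq> W" using r U' by blast
  have kQ: "k x \<in> ?B" "h (k x) = x" if "x \<in> Q" for x
    using that kh unfolding Q_def by auto
  define V where "V = \<sigma> ` ?B"
  have \<sigma>_cont: "continuous_map (top_of_set ?B) ?Y \<sigma>"
  proof -
    have "continuous_map (top_of_set ?B) (top_of_set (snd c ` fst c)) (\<lambda>y. a + l y)"
      using BW cont_al unfolding W_def by auto
    from continuous_map_compose[OF this is_chart_continuous_inv[OF chart]]
    have "continuous_map (top_of_set ?B) TX \<sigma>" by (simp add: \<sigma>_def o_def)
    then show ?thesis
      using \<sigma>(4) BW by (auto simp: continuous_map_in_subtopology)
  qed
  \<comment> \<open>Although defined as an image, \<open>V\<close> is cut out of \<open>N\<close> by
    an open condition on slice coordinates, because \<open>g\<close> reads off the parameter; hence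
    it is open in \<open>N\<close>.\<close>
  have V_eq: "V = N \<inter> {p \<in> fst c. snd c p \<in> {x. g (x - a) \<in> ?B}}"
  proof (intro set_eqI iffI)
    fix p assume "p \<in> V"
    then obtain y where y: "y \<in> ?B" "p = \<sigma> y" unfolding V_def by blast
    then have yW: "y \<in> W" using BW by blast
    have "g (snd c p - a) = y" using \<sigma>_param[OF _ _ yW, of p] \<sigma>[OF yW] y(2) by simp
    then show "p \<in> N \<inter> {p \<in> fst c. snd c p \<in> {x. g (x - a) \<in> ?B}}"
      using \<sigma>[OF yW] y by simp
  next
    fix p assume p: "p \<in> N \<inter> {p \<in> fst c. snd c p \<in> {x. g (x - a) \<in> ?B}}"
    then have yB: "g (snd c p - a) \<in> ?B" by simp
    then have "g (snd c p - a) \<in> W" using BW by blast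
    then have "p = \<sigma> (g (snd c p - a))"
      using \<sigma>_param[of p "g (snd c p - a)"] p by blast
    then show "p \<in> V" using yB unfolding V_def by blast
  qed
  have "open {x. g (x - a) \<in> ?B}"
  proof -
    have "continuous_on UNIV (\<lambda>x. g (x - a))"
      by (intro continuous_on_compose2[OF linear_continuous_on[OF bl(2), of UNIV]] continuous_intros) auto
    from open_vimage[OF open_ball[of 0 r] this] show ?thesis unfolding vimage_def .
  qed
  from is_chart_open_preimage[OF chart this]
  have V_open: "openin ?Y V"
    unfolding V_eq by (rule openin_subtopology_Int2)
  have VN: "V \<subseteq> N" unfolding V_eq by blast
  have fst_V: "fst ` V = {p \<in> fst d. snd d p \<in> Q}"
  proof (intro set_eqI iffI)
    fix p assume "p \<in> fst ` V"
    then obtain y where y: "y \<in> ?B" "p = fst (\<sigma> y)" unfolding V_def by blast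
    then have "\<sigma> y \<in> fst ?T" using \<sigma>(2) BW by blast
    moreover have "h y \<in> Q" using y(1) unfolding Q_def by blast
    ultimately show "p \<in> {p \<in> fst d. snd d p \<in> Q}"
      using y(2) h[of y] by (simp add: tangent_chart_fst)
  next
    fix p assume p: "p \<in> {p \<in> fst d. snd d p \<in> Q}"
    then obtain y where y: "y \<in> ?B" "snd d p = h y" unfolding Q_def by blast
    then have "fst (\<sigma> y) \<in> fst d" using \<sigma>(2)[of y] BW by (auto simp: tangent_chart_fst)
    then have "p = fst (\<sigma> y)"
      using y(2) p unfolding h by (intro inj_onD[OF atlas_inj[OF d(1)]]) simp_all
    then show "p \<in> fst ` V" using y(1) unfolding V_def by blast
  qed
  have fst_V_open: "openin X (fst ` V)"
    unfolding fst_V by (rule is_chart_open_preimage[OF atlas_chart[OF d(1)] Q(1)])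
  \<comment> \<open>The inverse of the projection on \<open>V\<close>: base coordinates, then the
    inverse \<open>k\<close> of \<open>h\<close>, then the parametrization.\<close>
  define s where "s = (\<lambda>p. \<sigma> (k (snd d p)))"
  have s_cont: "continuous_map (subtopology X (fst ` V)) ?Y s"
  proof -
    have d_cont: "continuous_map (subtopology X (fst ` V)) euclidean (snd d)"
      by (rule continuous_map_from_subtopology_mono[OF is_chart_continuous[OF atlas_chart[OF d(1)]]])
        (auto simp: fst_V)
    have "continuous_map (subtopology X (fst ` V)) (top_of_set Q) (snd d)"
      using d_cont by (auto simp: continuous_map_in_subtopology fst_V)
    moreover have "continuous_map (top_of_set Q) (top_of_set ?B) k"
      using kQ(1) continuous_on_subset[OF smooth_on_continuous[OF U'(6)] Q(2)] by auto
    ultimately have "continuous_map (subtopology X (fst ` V)) ?Y (\<sigma> \<circ> (k \<circ> snd d))"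
      by (rule continuous_map_compose[OF continuous_map_compose \<sigma>_cont])
    then show ?thesis unfolding s_def o_def .
  qed
  have s_V: "s (fst v) = v" if v: "v \<in> V" for v
  proof -
    obtain y where y: "y \<in> ?B" "v = \<sigma> y" using v unfolding V_def by blast
    then show ?thesis using kh[OF y(1)] by (simp add: s_def flip: h)
  qed
  show ?thesis
  proof (rule that[OF V_open _ _ fst_V_open s_cont s_V])
    show "z \<in> V" unfolding V_def using \<sigma>0 r(1) by (metis centre_in_ball imageI)
    show "path_connectedin ?Y V"
      unfolding V_def
    proof (rule path_connectedin_continuous_map_image[OF \<sigma>_cont])
      show "path_connectedin (top_of_set ?B) ?B"
        by (simp add: convex_imp_path_connected)
    qed
    fix e T assume e: "e \<in> A" and T': "T \<in> TA"
    let ?P = "{p \<in> fst e. p \<in> fst ` V \<and> s p \<in> fst T}"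
    have "openin TX (fst T)"
      using T' by (elim tangent_atlasE) (simp add: tangent_chart_openin)
    then have "openin ?Y (N \<inter> fst T)" by (rule openin_subtopology_Int2)
    from openin_continuous_map_preimage[OF s_cont this]
    have "openin (subtopology X (fst ` V)) {p \<in> topspace (subtopology X (fst ` V)). s p \<in> N \<inter> fst T}" .
    moreover have "{p \<in> topspace (subtopology X (fst ` V)). s p \<in> N \<inter> fst T} = {p \<in> fst ` V. s p \<in> fst T}"
      using openin_subset[OF fst_V_open] s_V VN by auto
    ultimately have "openin X {p \<in> fst ` V. s p \<in> fst T}"
      using openin_open_subtopology[OF fst_V_open] by simp
    from is_chart_open_image[OF atlas_chart[OF e] this]
    have P: "open (snd e ` ?P)"
      by (simp add: Int_def conj_ac)
    \<comment> \<open>Slice coordinates of the section as a function of the base coordinates in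
      \<open>e\<close>; everything in it is smooth, and the transition from \<open>c\<close> to
      \<open>T\<close> finishes the local expression.\<close>
    let ?f = "\<lambda>x. a + l (k (transition e d x))"
    have "smooth_on (\<lambda>x. transition c T (?f x)) (snd e ` ?P)"
    proof (rule smooth_on_compose[where f = ?f, OF P slice_overlap_open[OF c T'] _ _ slice_transition_smooth[OF c T']])
      show "?f ` snd e ` ?P \<subseteq> snd c ` (fst c \<inter> fst T)"
      proof (intro image_subsetI)
        fix x assume "x \<in> snd e ` ?P"
        then obtain p where p: "p \<in> fst e" "p \<in> fst ` V" "s p \<in> fst T" "x = snd e p" by blast
        have "k (snd d p) \<in> W" using p(2) kQ(1) BW unfolding fst_V by blast
        from \<sigma>[OF this] show "?f x \<in> snd c ` (fst c \<inter> fst T)"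
          using p local_rep_apply[OF atlas_inj[OF e] p(1), of d id]
          by (intro image_eqI[of _ _ "s p"]) (simp_all add: s_def)
      qed
      have sm: "smooth_on (transition e d) (snd e ` ?P)"
        by (rule smooth_on_subset[OF transition_smooth[OF e d(1)]]) (auto simp: fst_V)
      have "transition e d ` snd e ` ?P \<subseteq> Q"
        using local_rep_apply[OF atlas_inj[OF e], of _ d id] by (auto simp: fst_V)
      from smooth_on_compose[OF P Q(1) this sm smooth_on_subset[OF U'(6) Q(2)]]
      have "smooth_on (\<lambda>x. k (transition e d x)) (snd e ` ?P)" .
      from smooth_on_compose[OF P open_UNIV _ this smooth_on_affine[OF open_UNIV bl(1)]]
      show "smooth_on ?f (snd e ` ?P)" by simp
    qed
    then show "smooth_on (local_rep e T s) (snd e ` ?P)"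
    proof (rule smooth_on_cong_open[OF P, rotated])
      fix x assume "x \<in> snd e ` ?P"
      then obtain p where p: "p \<in> fst e" "x = snd e p" by blast
      then show "transition c T (?f x) = local_rep e T s x"
        using local_rep_apply[OF atlas_inj[OF e] p(1), of d id] local_rep_apply[OF atlas_inj[OF e] p(1), of T s]
        by (simp add: s_def \<sigma>_def local_rep_def)
    qed
  qed
qed

section \<open>The projection of \<open>N\<close> as a bijection and its smooth inverse\<close>

theorem theorem2p1:
  fixes X :: "'a topology"
    and A :: "('a, real ^ 'n) chart set"
    and g :: "'a \<Rightarrow> ('a, real ^ 'n) tvec \<Rightarrow> ('a, real ^ 'n) tvec \<Rightarrow> real"
    and N :: "('a \<times> ('a, real ^ 'n) tvec) set"
  assumes "smooth_manifold X A"
    and "riemannian_metric X A g"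
    and "connected_space X"
    and "simply_connected_space X"
    and "submanifold (tangent_topology X A) (tangent_atlas X A) CARD('n) N"
    and "N \<noteq> {}"
    and "connectedin (tangent_topology X A) N"
    and "compactin (tangent_topology X A) N"
    and "\<forall>z\<in>N. transverse_to_fiber X A N z"
  shows "compact_space X \<and> (\<exists>\<xi>. vector_field X A \<xi> \<and> \<xi> ` topspace X = N)"
proof -
  interpret smooth_mfd X A by unfold_locales (rule assms(1))
  let ?Y = "subtopology TX N"
  have NTX: "N \<subseteq> topspace TX" using assms(5) by (simp add: submanifold_def)
  have topY: "topspace ?Y = N" using NTX by auto
  \<comment> \<open>One predicate keeps the whole conclusion of
    \<open>transverse_local_section\<close>: the topological clauses feed the covering argument, the
    smoothness clause waits until \<open>\<xi>\<close> is known.\<close>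
  define good where "good V s \<longleftrightarrow> openin ?Y V \<and> path_connectedin ?Y V \<and> openin X (fst ` V) \<and>
    continuous_map (subtopology X (fst ` V)) ?Y s \<and> (\<forall>v\<in>V. s (fst v) = v) \<and>
    (\<forall>e\<in>A. \<forall>T\<in>TA. smooth_on (local_rep e T s) (snd e ` {p \<in> fst e. p \<in> fst ` V \<and> s p \<in> fst T}))" for V s
  have good: "openin ?Y V" "path_connectedin ?Y V" "openin X (fst ` V)"
      "continuous_map (subtopology X (fst ` V)) ?Y s" "\<forall>v\<in>V. s (fst v) = v"
      "\<And>e T. e \<in> A \<Longrightarrow> T \<in> TA \<Longrightarrow>
        smooth_on (local_rep e T s) (snd e ` {p \<in> fst e. p \<in> fst ` V \<and> s p \<in> fst T})"
    if "good V s" for V s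
    using that unfolding good_def by simp_all
  have ex: "\<exists>V s. z \<in> V \<and> good V s" if "z \<in> N" for z
    unfolding good_def by (rule transverse_local_section[OF assms(1,5,9) that]) blast
  interpret compact_local_homeo ?Y X fst
  proof
    show "compact_space ?Y" using assms(8) by (simp add: compact_space_subtopology)
    show "Hausdorff_space ?Y" by (rule Hausdorff_space_subtopology[OF Hausdorff_tangent])
    show "Hausdorff_space X" using assms(1) by (simp add: smooth_manifold_def)
    show "continuous_map ?Y X fst" by (rule continuous_map_from_subtopology[OF projection_continuous])
    show "\<exists>V s. openin ?Y V \<and> z \<in> V \<and> openin X (fst ` V) \<and>
        continuous_map (subtopology X (fst ` V)) ?Y s \<and> (\<forall>v\<in>V. s (fst v) = v)" if "z \<in> topspace ?Y" for z
    proof -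
      have "z \<in> N" using that unfolding topY .
      then obtain V s where V: "z \<in> V" "good V s" using ex by blast
      show ?thesis
        by (intro exI[of _ V] exI[of _ s] conjI V(1) good(1,3-5)[OF V(2)])
    qed
  qed
  have surj: "fst ` N = topspace X"
    using surjective[OF assms(3)] assms(6) unfolding topY by blast
  have "connected_space ?Y" using assms(7) by (simp add: connectedin_def)
  then have "path_connected_space ?Y"
  proof (rule path_connected_space_if_locally)
    fix z assume "z \<in> topspace ?Y"
    then have "z \<in> N" unfolding topY .
    then obtain V s where "z \<in> V" "good V s" using ex by blast
    then show "\<exists>W. openin ?Y W \<and> z \<in> W \<and> path_connectedin ?Y W"
      using good(1,2) by blast
  qed
  then have inj: "inj_on fst N"
    using injective[OF _ assms(4)] unfolding topY by blast
  define \<xi> where "\<xi> = inv_into N fst"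
  have \<xi>: "\<xi> (fst z) = z" if "z \<in> N" for z
    unfolding \<xi>_def using inj that by (rule inv_into_f_f)
  have \<xi>_N: "\<xi> p \<in> N" "fst (\<xi> p) = p" if "p \<in> topspace X" for p
    using that surj unfolding \<xi>_def by (simp_all add: inv_into_into f_inv_into_f)
  \<comment> \<open>Over the image of \<open>V\<close> the section \<open>s\<close> takes values in
    \<open>N\<close> above the right base point, so injectivity of the projection forces it to equal
    \<open>\<xi>\<close>.\<close>
  have local: "\<exists>V s. p \<in> fst ` V \<and> good V s \<and> (\<forall>q\<in>fst ` V. \<xi> q = s q)" if p: "p \<in> topspace X" for p
  proof -
    obtain V s where V: "\<xi> p \<in> V" "good V s" using ex[OF \<xi>_N(1)[OF p]] by blast
    have "V \<subseteq> N" using openin_subset[OF good(1)[OF V(2)]] topY by simp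
    then have "\<forall>q\<in>fst ` V. \<xi> q = s q" using good(5)[OF V(2)] \<xi> by auto
    moreover have "p \<in> fst ` V" using V(1) \<xi>_N(2)[OF p] by (metis imageI)
    ultimately show ?thesis using V(2) by blast
  qed
  have cont: "continuous_map X TX \<xi>"
  \<comment> \<open>All pieces to be glued are restrictions of the one map \<open>\<xi>\<close>, so
    only local continuity remains.\<close>
  proof (rule pasting_lemma[where I = "{V. openin X V \<and> continuous_map (subtopology X V) TX \<xi>}" and T = "\<lambda>V. V"
        and f = "\<lambda>_. \<xi>"])
    fix p assume "p \<in> topspace X"
    then obtain V s where V: "p \<in> fst ` V" "good V s" "\<forall>q\<in>fst ` V. \<xi> q = s q"
      using local by meson
    have "continuous_map (subtopology X (fst ` V)) TX s"
      using continuous_map_into_fulltopology[OF good(4)[OF V(2)]] .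
    then have "continuous_map (subtopology X (fst ` V)) TX \<xi>"
      by (rule continuous_map_eq) (use V(3) in auto)
    then show "\<exists>W. W \<in> {V. openin X V \<and> continuous_map (subtopology X V) TX \<xi>} \<and> p \<in> W \<and> \<xi> p = \<xi> p"
      using V(1) good(3)[OF V(2)] by blast
  qed auto
  have smooth: "smooth_on (local_rep e T \<xi>) (snd e ` {p \<in> fst e. \<xi> p \<in> fst T})"
    if e: "e \<in> A" and T: "T \<in> TA" for e T
  proof (rule smooth_on_local)
    fix x assume "x \<in> snd e ` {p \<in> fst e. \<xi> p \<in> fst T}"
    then obtain p where p: "p \<in> fst e" "\<xi> p \<in> fst T" "x = snd e p" by blast
    then have pX: "p \<in> topspace X" using atlas_subset[OF e] by blast
    obtain V s where V: "p \<in> fst ` V" "good V s" "\<And>q. q \<in> fst ` V \<Longrightarrow> \<xi> q = s q"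
      using local[OF pX] by blast
    let ?Q = "{p \<in> fst e. p \<in> fst ` V \<and> s p \<in> fst T}"
    have "openin TX (fst T)"
      using T by (elim tangent_atlasE) (simp add: tangent_chart_openin)
    \<comment> \<open>The continuity of \<open>\<xi>\<close> just proved makes the domain of the
      local expression open, as needed to replace \<open>s\<close> by \<open>\<xi>\<close>.\<close>
    then have "openin X {p \<in> topspace X. \<xi> p \<in> fst T}"
      by (rule openin_continuous_map_preimage[OF cont])
    then have "openin X (fst ` V \<inter> {p \<in> topspace X. \<xi> p \<in> fst T})"
      by (rule openin_Int[OF good(3)[OF V(2)]])
    from is_chart_open_image[OF atlas_chart[OF e] this]
    have "open (snd e ` (fst e \<inter> (fst ` V \<inter> {p \<in> topspace X. \<xi> p \<in> fst T})))" .
    moreover have "fst e \<inter> (fst ` V \<inter> {p \<in> topspace X. \<xi> p \<in> fst T}) = ?Q"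
    proof -
      have "\<xi> q \<in> fst T \<longleftrightarrow> s q \<in> fst T" if "q \<in> fst ` V" for q
        using V(3)[OF that] by simp
      then show ?thesis using atlas_subset[OF e] by blast
    qed
    ultimately have Q: "open (snd e ` ?Q)" by simp
    have "smooth_on (local_rep e T s) (snd e ` ?Q)" by (rule good(6)[OF V(2) e T])
    then have "smooth_on (local_rep e T \<xi>) (snd e ` ?Q)"
    proof (rule smooth_on_cong_open[OF Q, rotated])
      fix y assume "y \<in> snd e ` ?Q"
      then obtain q where "q \<in> fst e" "q \<in> fst ` V" "y = snd e q" by blast
      then show "local_rep e T s y = local_rep e T \<xi> y"
        using V(3) by (simp add: local_rep_apply[OF atlas_inj[OF e]])
    qed
    moreover have "x \<in> snd e ` ?Q" using p V(1,3) by auto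
    ultimately show "\<exists>U. open U \<and> x \<in> U \<and> smooth_on (local_rep e T \<xi>) U" using Q by blast
  qed
  have "vector_field X A \<xi>"
    unfolding vector_field_def smooth_map_def using cont smooth \<xi>_N(2) by blast
  moreover have "\<xi> ` topspace X = N"
    using \<xi> \<xi>_N surj by force
  moreover have "compact_space X"
    using image_compactin[OF assms(8) projection_continuous] surj by (simp add: compact_space_def)
  ultimately show ?thesis by blast
qed

end
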